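(* The following two Lax representations (pairs of edge based matrices $L,M$ on $\mathbb{Z}^2$ satisfying $M_1L=L_2M$) are gauge equivalent: (a) the Lax representation for discrete nets of constant negative Gaussian curvature with unitary $t_{(i)}$, $$L=\begin{pmatrix}\frac1{t_{(1)}}\frac lr+t_{(1)}lr_1&\mathrm{i}(\lambda-\frac{rr_1}\lambda)\\\mathrm{i}(\lambda-\frac1{\lambda rr_1})&\frac1{t_{(1)}}\frac rl+t_{(1)}\frac1{lr_1}\end{pmatrix},\qquad M=\begin{pmatrix}\frac1{t_{(2)}}\frac mr+t_{(2)}mr_2&\mathrm{i}(\lambda-\frac{rr_2}\lambda)\\\mathrm{i}(\lambda-\frac1{\lambda rr_2})&\frac1{t_{(2)}}\frac rm+t_{(2)}\frac1{mr_2}\end{pmatrix},\qquad\lambda=e^t,$$ where $r$ is a function on vertices with values in the unit circle $\mathbb{S}^1$, $t_{(1)},t_{(2)}\in\mathbb{S}^1$ are edge functions with the labelling property, and $l,m\in\mathbb{C}\setminus\{0\}$ are edge functions; (b) the Lax representation on the diagonal net $D=\{(i,j,i,j)\}\cong\mathbb{Z}^2$ of a $C^-$ lattice with unitary labels $\alpha^i\in\mathbb{S}^1$, $$L=(\lambda+\tfrac1\lambda p^3_1)(\lambda+\tfrac1\lambda p^1),\qquad M=(\lambda+\tfrac1\lambda p^4_2)(\lambda+\tfrac1\lambda p^2),\qquad\lambda=e^t,$$ where $p^i=\begin{pmatrix}0&d^i\\-(\alpha^i)^2/d^i&0\end{pmatrix}$ is the map of the $C^-$ lattice with edges $d^i$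 and labelling $\alpha$.
   Context: Gauge equivalence. For a pair $L$ (on edges of the first direction of $\mathbb{Z}^2$), $M$ (on edges of the second direction) depending on a spectral parameter $\lambda$, subscripts denote shifts in the lattice directions of $\mathbb{Z}^2$; $M_1L=L_2M$ is the compatibility condition of the frame equations $\Phi_1=L\Phi$, $\Phi_2=M\Phi$. A gauge is a transformation $\Phi\mapsto G\Phi$ with a vertex based invertible matrix $G$ not depending on $\lambda$, so $L\mapsto G_1LG^{-1}$, $M\mapsto G_2MG^{-1}$. Two Lax representations are gauge equivalent if every solution pair of either one can be transformed into a solution pair of the other by a gauge, together with a reparametrization of the spectral parameter (such as $\lambda^2\to\lambda$) and multiplication of the matrices by nonzero scalars that do not affect the compatibility condition. An edge function has the labelling property if its value on edges in direction $i$ depends only on the $i$-th coordinate. In (a) the matrices are quaternion-valued, i.e. of the form $\begin{pmatrix}a&b\\-\bar b&\bar a\end{pmatrix}$, since they describe nets $f_t=\Phi^{-1}\Phi'$ in Euclidean three-space $\operatorname{Im}(\mathbb{H})$. $C^-$ lattice. For maps on $\mathbb{Z}^4$ write $f_i=f(x+e_i)$, $f_{ij}=f(x+e_i+e_j)$, and for edge based maps $p^i=p^i(x)$ (value on $(x,x+e_i)$), $p^i_j=p^i(x+e_j)$. A cross-ratio system is a map $f:\mathbb{Z}^4\to\mathbb{C}$, with the four points of each quad pairwise distinct, together with an edge labelling $\alpha$ with values in $\mathbb{C}\setminus\{0\}$, $\alpha^i_j=\alpha^i$ for $i\neq j$, such that with $d^i=f_i-f$ one has $\frac{d^id^i_j}{d^jd^j_i}=\frac{(\alpha^i)^2}{(\alpha^j)^2}$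 for $i\neq j$. Its map $s:\mathbb{Z}^4\to\mathbb{C}$ is defined by $s(\mathbf{0})=1$, $d^i=\alpha^is_is$. It is a $C^-$ lattice if for every $x\in D$: $s_1(x)\bar s_3(x)=1$, $s_2(x)\bar s_4(x)=1$, $\alpha^1(x)=\bar\alpha^3(x)$, $\alpha^2(x)=\bar\alpha^4(x)$. Nondegeneracy (pairwise distinct points on quads) is a standing assumption, so only solutions of (a) corresponding to nondegenerate lattices are considered. *)

theory Defs
  imports "HOL-Analysis.Analysis"
begin

section \<open>Lax pairs on \<open>\<int>\<^sup>2\<close> and gauge equivalence\<close>

abbreviation edir :: "'n::finite \<Rightarrow> int ^ 'n" where
  "edir i \<equiv> axis i 1"

definition mat2 :: "complex \<Rightarrow> complex \<Rightarrow> complex \<Rightarrow> complex \<Rightarrow> complex ^ 2 ^ 2" where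
  "mat2 a b c d = vector [vector [a, b], vector [c, d]]"

text \<open>
  An edge based matrix in direction \<open>i\<close> is a function of the initial vertex \<open>x\<close> of the edge
  \<open>(x, x + edir i)\<close> and of the spectral parameter \<open>z = e\<^sup>t\<close> (usually called \<open>\<lambda>\<close>). Since \<open>t\<close> is
  real, only the values at \<open>z > 0\<close> are relevant.
\<close>

type_synonym lax_matrix = "int ^ 2 \<Rightarrow> real \<Rightarrow> complex ^ 2 ^ 2"

definition compatible :: "lax_matrix \<Rightarrow> lax_matrix \<Rightarrow> bool" where
  "compatible L M \<longleftrightarrow>
     (\<forall>x z. z > 0 \<longrightarrow> M (x + edir 1) z ** L x z = L (x + edir 2) z ** M x z)"

text \<open>
  The map \<open>\<phi>\<close> is the reparametrization of the spectral parameter; \<open>c\<close> and \<open>c'\<close> are the scalar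
  factors of \<open>L\<close> and \<open>M\<close>, and the equation between them expresses that they cancel in
  \<open>M\<^sub>1 L = L\<^sub>2 M\<close>.
\<close>

definition gauge_transformable ::
    "lax_matrix \<times> lax_matrix \<Rightarrow> lax_matrix \<times> lax_matrix \<Rightarrow> bool" where
  "gauge_transformable = (\<lambda>(L, M) (L', M').
     \<exists>(G :: int ^ 2 \<Rightarrow> complex ^ 2 ^ 2) \<phi> \<psi>
      (c :: int ^ 2 \<Rightarrow> real \<Rightarrow> complex) (c' :: int ^ 2 \<Rightarrow> real \<Rightarrow> complex).
       (\<forall>x. invertible (G x)) \<and>
       homeomorphism {0<..} {0<..} \<phi> \<psi> \<and>
       (\<forall>x z. z > 0 \<longrightarrow>
          c x z \<noteq> 0 \<and> c' x z \<noteq> 0 \<and>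
          c' (x + edir 1) z * c x z = c (x + edir 2) z * c' x z \<and>
          L' x (\<phi> z) = mat (c x z) ** (G (x + edir 1) ** L x z ** matrix_inv (G x)) \<and>
          M' x (\<phi> z) = mat (c' x z) ** (G (x + edir 2) ** M x z ** matrix_inv (G x))))"

text \<open>A Lax representation is given by the set of its solution pairs.\<close>

definition gauge_equivalent ::
    "(lax_matrix \<times> lax_matrix) set \<Rightarrow> (lax_matrix \<times> lax_matrix) set \<Rightarrow> bool" where
  "gauge_equivalent A B \<longleftrightarrow>
     (\<forall>P\<in>A. \<exists>Q\<in>B. gauge_transformable P Q) \<and> (\<forall>Q\<in>B. \<exists>P\<in>A. gauge_transformable Q P)"


section \<open>Cross-ratio systems and \<open>C\<^sup>-\<close> lattices\<close>

definition edge_diff :: "(int ^ 4 \<Rightarrow> complex) \<Rightarrow> 4 \<Rightarrow> int ^ 4 \<Rightarrow> complex" where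
  "edge_diff f i x = f (x + edir i) - f x"

definition cross_ratio_system ::
    "(int ^ 4 \<Rightarrow> complex) \<Rightarrow> (4 \<Rightarrow> int ^ 4 \<Rightarrow> complex) \<Rightarrow> bool" where
  "cross_ratio_system f \<alpha> \<longleftrightarrow>
     (\<forall>i x. \<alpha> i x \<noteq> 0) \<and>
     (\<forall>i j x. i \<noteq> j \<longrightarrow>
        distinct [f x, f (x + edir i), f (x + edir i + edir j), f (x + edir j)] \<and>
        \<alpha> i (x + edir j) = \<alpha> i x \<and>
        (edge_diff f i x * edge_diff f i (x + edir j)) / (edge_diff f j x * edge_diff f j (x + edir i)) =
          (\<alpha> i x)\<^sup>2 / (\<alpha> j x)\<^sup>2)"

text \<open>For a cross-ratio system there is exactly one such map \<open>s\<close>.\<close>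

definition s_map_of ::
    "(int ^ 4 \<Rightarrow> complex) \<Rightarrow> (4 \<Rightarrow> int ^ 4 \<Rightarrow> complex) \<Rightarrow> (int ^ 4 \<Rightarrow> complex) \<Rightarrow> bool" where
  "s_map_of f \<alpha> s \<longleftrightarrow>
     s 0 = 1 \<and> (\<forall>i x. edge_diff f i x = \<alpha> i x * s (x + edir i) * s x)"

definition diagonal :: "int ^ 2 \<Rightarrow> int ^ 4" where
  "diagonal x = vector [x $ 1, x $ 2, x $ 1, x $ 2]"

definition C_minus_lattice ::
    "(int ^ 4 \<Rightarrow> complex) \<Rightarrow> (4 \<Rightarrow> int ^ 4 \<Rightarrow> complex) \<Rightarrow> bool" where
  "C_minus_lattice f \<alpha> \<longleftrightarrow> cross_ratio_system f \<alpha> \<and>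
     (\<exists>s. s_map_of f \<alpha> s \<and>
       (\<forall>x\<in>range diagonal.
          s (x + edir 1) * cnj (s (x + edir 3)) = 1 \<and>
          s (x + edir 2) * cnj (s (x + edir 4)) = 1 \<and>
          \<alpha> 1 x = cnj (\<alpha> 3 x) \<and> \<alpha> 2 x = cnj (\<alpha> 4 x)))"

definition p_matrix ::
    "(int ^ 4 \<Rightarrow> complex) \<Rightarrow> (4 \<Rightarrow> int ^ 4 \<Rightarrow> complex) \<Rightarrow> 4 \<Rightarrow> int ^ 4 \<Rightarrow> complex ^ 2 ^ 2" where
  "p_matrix f \<alpha> i x = mat2 0 (edge_diff f i x) (- (\<alpha> i x)\<^sup>2 / edge_diff f i x) 0"

definition transport ::
    "(int ^ 4 \<Rightarrow> complex) \<Rightarrow> (4 \<Rightarrow> int ^ 4 \<Rightarrow> complex) \<Rightarrow> 4 \<Rightarrow> int ^ 4 \<Rightarrow> real \<Rightarrow> complex ^ 2 ^ 2"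
  where "transport f \<alpha> i x z = z *\<^sub>R mat 1 + (1 / z) *\<^sub>R p_matrix f \<alpha> i x"

text \<open>
  A step in the direction \<open>k \<in> {1, 2}\<close> of the diagonal net is a step in the direction \<open>k\<close>
  followed by a step in the direction \<open>k + 2\<close> of \<open>\<int>\<^sup>4\<close>.
\<close>

definition C_minus_L :: "(int ^ 4 \<Rightarrow> complex) \<Rightarrow> (4 \<Rightarrow> int ^ 4 \<Rightarrow> complex) \<Rightarrow> lax_matrix" where
  "C_minus_L f \<alpha> x z =
     transport f \<alpha> 3 (diagonal x + edir 1) z ** transport f \<alpha> 1 (diagonal x) z"

definition C_minus_M :: "(int ^ 4 \<Rightarrow> complex) \<Rightarrow> (4 \<Rightarrow> int ^ 4 \<Rightarrow> complex) \<Rightarrow> lax_matrix" where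
  "C_minus_M f \<alpha> x z =
     transport f \<alpha> 4 (diagonal x + edir 2) z ** transport f \<alpha> 2 (diagonal x) z"

definition C_minus_representation :: "(lax_matrix \<times> lax_matrix) set" where
  "C_minus_representation =
     {(C_minus_L f \<alpha>, C_minus_M f \<alpha>) | f \<alpha>.
        C_minus_lattice f \<alpha> \<and> (\<forall>i x. norm (\<alpha> i x) = 1) \<and>
        compatible (C_minus_L f \<alpha>) (C_minus_M f \<alpha>)}"


section \<open>Nets of constant negative Gaussian curvature\<close>

text \<open>
  The common form of \<open>L\<close> and \<open>M\<close>: the direction is \<open>k\<close>, and \<open>l\<close> stands for the edge function
  \<open>l\<close> respectively \<open>m\<close>.
\<close>

definition K_net_matrix ::
    "(int ^ 2 \<Rightarrow> complex) \<Rightarrow> (2 \<Rightarrow> int ^ 2 \<Rightarrow> complex) \<Rightarrow> (int ^ 2 \<Rightarrow> complex) \<Rightarrow> 2 \<Rightarrow> lax_matrix" where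
  "K_net_matrix r t l k x z =
     mat2 (1 / t k x * (l x / r x) + t k x * l x * r (x + edir k))
          (\<i> * (of_real z - r x * r (x + edir k) / of_real z))
          (\<i> * (of_real z - 1 / (of_real z * r x * r (x + edir k))))
          (1 / t k x * (r x / l x) + t k x * (1 / (l x * r (x + edir k))))"

definition labelling :: "(2 \<Rightarrow> int ^ 2 \<Rightarrow> complex) \<Rightarrow> bool" where
  "labelling t \<longleftrightarrow> (\<forall>i x y. x $ i = y $ i \<longrightarrow> t i x = t i y)"

definition quaternionic :: "complex ^ 2 ^ 2 \<Rightarrow> bool" where
  "quaternionic A \<longleftrightarrow> (\<exists>a b. A = mat2 a b (- cnj b) (cnj a))"

text \<open>
  Nondegeneracy of the lattice that corresponds to a solution \<open>r, t, l, m\<close>. The labels of this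
  lattice are \<open>\<alpha>\<^sup>1 = 1/t\<^sub>1\<close>, \<open>\<alpha>\<^sup>3 = t\<^sub>1\<close>, \<open>\<alpha>\<^sup>2 = 1/t\<^sub>2\<close>, \<open>\<alpha>\<^sup>4 = t\<^sub>2\<close>. Its map \<open>s\<close> takes, along
  the diagonal net, the values \<open>s = r\<close>, \<open>s\<^sub>1 = 1/l\<close>, \<open>s\<^sub>2 = 1/m\<close> at the even vertices of \<open>\<int>\<^sup>2\<close> and
  \<open>s = 1/r\<close>, \<open>s\<^sub>1 = l\<close>, \<open>s\<^sub>2 = m\<close> at the odd ones; this is how the entries of the two kinds of
  matrices match. (The normalization \<open>s(0) = 1\<close> is dropped here: multiplying \<open>s\<close> by a constant on
  the even vertices of \<open>\<int>\<^sup>4\<close> and by its inverse on the odd ones has no effect on any of the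
  quantities below being zero.)

  In terms of \<open>s\<close> the cross-ratio equation of a quad reads
  \<open>s\<^sub>i\<^sub>j (\<alpha>\<^sup>j s\<^sub>i - \<alpha>\<^sup>i s\<^sub>j) = s (\<alpha>\<^sup>j s\<^sub>j - \<alpha>\<^sup>i s\<^sub>i)\<close>, so that three of the values determine the fourth,
  and the points of the lattice satisfy
  \<open>f\<^sub>j - f\<^sub>i = s (\<alpha>\<^sup>j s\<^sub>j - \<alpha>\<^sup>i s\<^sub>i)\<close> and \<open>f\<^sub>i\<^sub>j - f = s\<^sub>i (\<alpha>\<^sup>i s + \<alpha>\<^sup>j s\<^sub>i\<^sub>j)\<close>.
  The predicate \<open>propagated\<close> collects all values that arise from the initial ones by solving the
  equation on quads, neither assuming that this can be done without degeneration nor that different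
  ways of arriving at the same vertex yield the same value. A numerator below
  vanishes iff two opposite points of the quad coincide, a denominator vanishes iff the point to be
  determined is not finite; because of \<open>z / 0 = 0\<close> the value \<open>0\<close> is produced in both cases. Hence
  no degeneration occurs iff \<open>0\<close> is not among the propagated values.
\<close>

definition induced_label :: "(2 \<Rightarrow> int ^ 2 \<Rightarrow> complex) \<Rightarrow> 4 \<Rightarrow> int ^ 4 \<Rightarrow> complex" where
  "induced_label t i x =
     (if i = 1 then 1 / t 1 (vector [x $ 1, x $ 2])
      else if i = 2 then 1 / t 2 (vector [x $ 1, x $ 2])
      else if i = 3 then t 1 (vector [x $ 3, x $ 4])
      else t 2 (vector [x $ 3, x $ 4]))"

definition alternate :: "int ^ 2 \<Rightarrow> complex \<Rightarrow> complex" where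
  "alternate x z = (if even (x $ 1 + x $ 2) then z else 1 / z)"

inductive propagated ::
    "(int ^ 2 \<Rightarrow> complex) \<Rightarrow> (2 \<Rightarrow> int ^ 2 \<Rightarrow> complex) \<Rightarrow> (int ^ 2 \<Rightarrow> complex) \<Rightarrow> (int ^ 2 \<Rightarrow> complex) \<Rightarrow>
       int ^ 4 \<Rightarrow> complex \<Rightarrow> bool"
  for r t l m where
    vertex: "propagated r t l m (diagonal x) (alternate x (r x))"
  | edge1: "propagated r t l m (diagonal x + edir 1) (alternate x (1 / l x))"
  | edge2: "propagated r t l m (diagonal x + edir 2) (alternate x (1 / m x))"
  | forward:
      "\<lbrakk>i \<noteq> j; propagated r t l m x s; propagated r t l m (x + edir i) s\<^sub>i;
        propagated r t l m (x + edir j) s\<^sub>j; a\<^sub>i = induced_label t i x; a\<^sub>j = induced_label t j x\<rbrakk>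
       \<Longrightarrow> propagated r t l m (x + edir i + edir j)
             (s * (a\<^sub>j * s\<^sub>j - a\<^sub>i * s\<^sub>i) / (a\<^sub>j * s\<^sub>i - a\<^sub>i * s\<^sub>j))"
  | sideways:
      "\<lbrakk>i \<noteq> j; propagated r t l m x s; propagated r t l m (x + edir i) s\<^sub>i;
        propagated r t l m (x + edir i + edir j) s\<^sub>i\<^sub>j;
        a\<^sub>i = induced_label t i x; a\<^sub>j = induced_label t j x\<rbrakk>
       \<Longrightarrow> propagated r t l m (x + edir j)
             (s\<^sub>i * (a\<^sub>i * s + a\<^sub>j * s\<^sub>i\<^sub>j) / (a\<^sub>j * s + a\<^sub>i * s\<^sub>i\<^sub>j))"
  | backward:
      "\<lbrakk>i \<noteq> j; propagated r t l m (x + edir i) s\<^sub>i; propagated r t l m (x + edir j) s\<^sub>j;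
        propagated r t l m (x + edir i + edir j) s\<^sub>i\<^sub>j;
        a\<^sub>i = induced_label t i x; a\<^sub>j = induced_label t j x\<rbrakk>
       \<Longrightarrow> propagated r t l m x
             (s\<^sub>i\<^sub>j * (a\<^sub>j * s\<^sub>i - a\<^sub>i * s\<^sub>j) / (a\<^sub>j * s\<^sub>j - a\<^sub>i * s\<^sub>i))"

definition nondegenerate ::
    "(int ^ 2 \<Rightarrow> complex) \<Rightarrow> (2 \<Rightarrow> int ^ 2 \<Rightarrow> complex) \<Rightarrow> (int ^ 2 \<Rightarrow> complex) \<Rightarrow> (int ^ 2 \<Rightarrow> complex) \<Rightarrow> bool"
  where "nondegenerate r t l m \<longleftrightarrow> (\<forall>x. \<not> propagated r t l m x 0)"

definition K_net_representation :: "(lax_matrix \<times> lax_matrix) set" where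
  "K_net_representation =
     {(K_net_matrix r t l 1, K_net_matrix r t m 2) | r t l m.
        (\<forall>x. norm (r x) = 1) \<and> (\<forall>i x. norm (t i x) = 1) \<and> labelling t \<and>
        (\<forall>x. l x \<noteq> 0) \<and> (\<forall>x. m x \<noteq> 0) \<and>
        (\<forall>x z. z > 0 \<longrightarrow>
           quaternionic (K_net_matrix r t l 1 x z) \<and> quaternionic (K_net_matrix r t m 2 x z)) \<and>
        nondegenerate r t l m \<and>
        compatible (K_net_matrix r t l 1) (K_net_matrix r t m 2)}"

end

theory Submission imports Defs
begin

text \<open>
  In terms of the map \<open>s\<close>, the Lax matrices of a \<open>C\<^sup>-\<close> lattice and of a net of constant negative
  curvature have the same entries, up to rows and columns being interchanged at every second vertex
  (where \<open>s = 1/r\<close> instead of \<open>s = r\<close>); a constant gauge does the interchange. Quaternionic values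
  of the matrices amount to the duality \<open>s\<^sub>1 \<cdot> cnj s\<^sub>3 = 1\<close>, given the cross-ratio equation.

  The work is in building the lattice on \<open>\<int>\<^sup>4\<close> from a solution on \<open>\<int>\<^sup>2\<close>. The compatibility
  condition yields the cross-ratio equation on a quad surface through the diagonal net,
  namely over \<open>x\<^sub>1 - x\<^sub>3 \<in> {0, 1}\<close>, \<open>x\<^sub>2 - x\<^sub>4 \<in> {0, 1}\<close>. From there the solution is extended in the
  directions \<open>1, 3\<close> and then in the directions \<open>2, 4\<close>; consistency around the cube carries the
  remaining quad equations along.
\<close>

text \<open>Two obstacles shape the construction of the lattice. The first is a circularity:
  consistency around a cube presupposes nondegenerate faces, while distinctness of the points of a
  lattice presupposes that the lattice exists. \<open>propagated\<close> resolves it. Every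
  constructed value is among the values that can be solved for in some order, so any four such
  values around a quad satisfy all the inequalities, whether or not the quad equation is already
  known there. The second is that compatibility constrains only products of two lattice steps,
  whereas a lattice needs the equation on every single quad. Such a product is singular at isolated
  parameters, and there its kernel is that of its right factor; this recovers the equations of the
  individual quads. Over a cell of the diagonal net lie nine vertices of the surface, and all but
  the central one carry data of the net. One quad fixes the central value, and compatibility has to
  yield the other three quads.\<close>

section \<open>Gauge transformations between the Lax matrices\<close>

lemma mat2_nth [simp]:
  "mat2 a b c d $ 1 $ 1 = a" "mat2 a b c d $ 1 $ 2 = b"
  "mat2 a b c d $ 2 $ 1 = c" "mat2 a b c d $ 2 $ 2 = d"
  by (simp_all add: mat2_def)

lemma mat2_eqI:
  fixes A B :: "complex ^ 2 ^ 2"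
  assumes "A $ 1 $ 1 = B $ 1 $ 1" "A $ 1 $ 2 = B $ 1 $ 2" "A $ 2 $ 1 = B $ 2 $ 1" "A $ 2 $ 2 = B $ 2 $ 2"
  shows "A = B"
  using assms by (simp add: vec_eq_iff forall_2)

lemma mat2_eq_iff [simp]:
  "mat2 a b c d = mat2 a' b' c' d' \<longleftrightarrow> a = a' \<and> b = b' \<and> c = c' \<and> d = d'"
  by (metis mat2_nth)

lemma mat2_mult [simp]:
  "mat2 a b c d ** mat2 a' b' c' d' =
     mat2 (a * a' + b * c') (a * b' + b * d') (c * a' + d * c') (c * b' + d * d')"
  by (rule mat2_eqI) (simp_all add: matrix_matrix_mult_def sum_2)

lemma mat_eq_mat2: "mat c = mat2 c 0 0 c"
  by (rule mat2_eqI) (simp_all add: mat_def)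

lemma scaleR_mat2 [simp]:
  "a *\<^sub>R mat2 p q u v = mat2 (of_real a * p) (of_real a * q) (of_real a * u) (of_real a * v)"
  by (rule mat2_eqI) (simp_all add: scaleR_conv_of_real[where 'a = complex])

lemma add_mat2 [simp]:
  "mat2 a b c d + mat2 a' b' c' d' = mat2 (a + a') (b + b') (c + c') (d + d')"
  by (rule mat2_eqI) simp_all

lemma matrix_inv:
  fixes A :: "complex ^ 2 ^ 2"
  assumes "invertible A"
  shows matrix_inv_right: "A ** matrix_inv A = mat 1"
    and matrix_inv_left: "matrix_inv A ** A = mat 1"
  using someI_ex[OF assms[unfolded invertible_def]] by (simp_all add: matrix_inv_def)

lemma matrix_inv_eqI:
  fixes A B :: "complex ^ 2 ^ 2"
  assumes "A ** B = mat 1" "B ** A = mat 1"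
  shows "matrix_inv A = B"
  by (metis assms invertible_def matrix_inv_right matrix_mul_assoc matrix_mul_lid matrix_mul_rid)

lemma mat_mult_commute: "A ** mat c = mat c ** (A :: complex ^ 2 ^ 2)"
  by (rule mat2_eqI) (simp_all add: mat_def matrix_matrix_mult_def sum_2)

lemma mat_mult_mat: "mat a ** mat b = (mat (a * b) :: complex ^ 2 ^ 2)"
  by (simp add: mat_eq_mat2)

lemma mat_left_commute:
  fixes A B :: "complex ^ 2 ^ 2"
  shows "A ** (mat c ** B) = mat c ** (A ** B)"
proof -
  have "A ** (mat c ** B) = (A ** mat c) ** B"
    by (rule matrix_mul_assoc)
  also have "\<dots> = mat c ** (A ** B)"
    by (simp only: mat_mult_commute[of A] matrix_mul_assoc[symmetric])
  finally show ?thesis .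
qed

lemma matrix_inv_left_cancel:
  fixes A B :: "complex ^ 2 ^ 2"
  assumes "invertible A"
  shows "matrix_inv A ** (A ** B) = B"
  by (simp add: matrix_mul_assoc matrix_inv_left assms)

lemma matrix_inv_matrix_inv:
  fixes A :: "complex ^ 2 ^ 2"
  assumes "invertible A"
  shows "matrix_inv (matrix_inv A) = A"
  by (rule matrix_inv_eqI) (simp_all add: assms matrix_inv)

section \<open>Inverting gauges, and invariance of the compatibility condition\<close>

lemma gauge_solve:
  fixes A B X :: "complex ^ 2 ^ 2"
  assumes "invertible A" "invertible B" "c \<noteq> 0"
  shows "mat (1 / c) ** (matrix_inv A ** (mat c ** (A ** X ** matrix_inv B)) ** B) = X"
proof -
  have "matrix_inv A ** (mat c ** (A ** X ** matrix_inv B)) ** B =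
      mat c ** (matrix_inv A ** (A ** X ** matrix_inv B)) ** B"
    by (simp only: mat_left_commute)
  also have "\<dots> = mat c ** X"
    by (simp add: matrix_mul_assoc[symmetric] matrix_inv_left_cancel matrix_inv_left assms)
  finally show ?thesis
    using assms(3) by (simp add: matrix_mul_assoc mat_mult_mat)
qed

text \<open>Gauges are only constructed with a net as target. Symmetry supplies the opposite
  direction, and it also lets compatibility be carried away from the net.\<close>

lemma gauge_transformable_sym:
  assumes "gauge_transformable P Q"
  shows "gauge_transformable Q P"
proof -
  obtain L M L' M' where PQ: "P = (L, M)" "Q = (L', M')"
    by fastforce
  from assms obtain G \<phi> \<psi> c c' where inv: "\<And>x. invertible (G x)"
    and hom: "homeomorphism {0<..} {0<..} \<phi> \<psi>"
    and *: "\<And>x z. z > 0 \<Longrightarrow> c x z \<noteq> 0 \<and> c' x z \<noteq> 0 \<and>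
          c' (x + edir 1) z * c x z = c (x + edir 2) z * c' x z \<and>
          L' x (\<phi> z) = mat (c x z) ** (G (x + edir 1) ** L x z ** matrix_inv (G x)) \<and>
          M' x (\<phi> z) = mat (c' x z) ** (G (x + edir 2) ** M x z ** matrix_inv (G x))"
    unfolding PQ gauge_transformable_def prod.case by blast
  have pos: "\<psi> z > 0" "\<phi> (\<psi> z) = z" if "z > 0" for z
    using hom that unfolding homeomorphism_def by auto
  show ?thesis
    unfolding PQ gauge_transformable_def prod.case
  proof (intro exI conjI allI impI)
    show "homeomorphism {0<..} {0<..} \<psi> \<phi>"
      using hom homeomorphism_sym by blast
    show "invertible (matrix_inv (G x))" for x
      unfolding invertible_def using matrix_inv[OF inv[of x]] by blast
    fix x and z :: real
    assume "z > 0"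
    note ** = *[OF pos(1)[OF this], of x, unfolded pos(2)[OF this]]
    have nz: "c x (\<psi> z) \<noteq> 0" "c' x (\<psi> z) \<noteq> 0"
      using ** by blast+
    have eq: "L' x z = mat (c x (\<psi> z)) ** (G (x + edir 1) ** L x (\<psi> z) ** matrix_inv (G x))"
      "M' x z = mat (c' x (\<psi> z)) ** (G (x + edir 2) ** M x (\<psi> z) ** matrix_inv (G x))"
      using ** by blast+
    show "1 / c x (\<psi> z) \<noteq> 0" "1 / c' x (\<psi> z) \<noteq> 0"
      using nz by simp_all
    show "1 / c' (x + edir 1) (\<psi> z) * (1 / c x (\<psi> z)) =
        1 / c (x + edir 2) (\<psi> z) * (1 / c' x (\<psi> z))"
      using ** by simp
    show "L x (\<psi> z) = mat (1 / c x (\<psi> z)) **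
        (matrix_inv (G (x + edir 1)) ** L' x z ** matrix_inv (matrix_inv (G x)))"
      "M x (\<psi> z) = mat (1 / c' x (\<psi> z)) **
        (matrix_inv (G (x + edir 2)) ** M' x z ** matrix_inv (matrix_inv (G x)))"
      unfolding eq matrix_inv_matrix_inv[OF inv]
      by (simp_all only: gauge_solve[OF inv inv nz(1)] gauge_solve[OF inv inv nz(2)])
  qed
qed

lemma gauge_product:
  fixes A B C X Y :: "complex ^ 2 ^ 2"
  assumes "invertible B"
  shows "(mat a ** (A ** X ** matrix_inv B)) ** (mat b ** (B ** Y ** matrix_inv C)) =
         mat (a * b) ** (A ** (X ** Y) ** matrix_inv C)"
proof -
  have "(mat a ** (A ** X ** matrix_inv B)) ** (mat b ** (B ** Y ** matrix_inv C)) =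
      mat b ** ((mat a ** (A ** X ** matrix_inv B)) ** (B ** Y ** matrix_inv C))"
    by (rule mat_left_commute)
  also have "\<dots> = mat b ** (mat a ** (A ** (X ** Y) ** matrix_inv C))"
    by (simp add: matrix_mul_assoc[symmetric] matrix_inv_left_cancel assms)
  also have "\<dots> = mat (a * b) ** (A ** (X ** Y) ** matrix_inv C)"
    by (simp add: matrix_mul_assoc mat_mult_mat mult.commute)
  finally show ?thesis .
qed

text \<open>Along both ways around a quad the gauge matrices telescope to those at the two end
  vertices, and the scalar factors agree by assumption. Every positive parameter is a value of
  \<phi>, so none is left out.\<close>

lemma gauge_transformable_compatible:
  assumes "gauge_transformable (L, M) (L', M')" "compatible L M"
  shows "compatible L' M'"
  unfolding compatible_def
proof (intro allI impI)
  fix x and z :: real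
  assume "z > 0"
  from assms(1) obtain G \<phi> \<psi> c c' where inv: "\<And>x. invertible (G x)"
    and hom: "homeomorphism {0<..} {0<..} \<phi> \<psi>"
    and *: "\<And>x z. z > 0 \<Longrightarrow> c x z \<noteq> 0 \<and> c' x z \<noteq> 0 \<and>
          c' (x + edir 1) z * c x z = c (x + edir 2) z * c' x z \<and>
          L' x (\<phi> z) = mat (c x z) ** (G (x + edir 1) ** L x z ** matrix_inv (G x)) \<and>
          M' x (\<phi> z) = mat (c' x z) ** (G (x + edir 2) ** M x z ** matrix_inv (G x))"
    unfolding gauge_transformable_def prod.case by blast
  obtain w where w: "w > 0" "z = \<phi> w"
    using hom \<open>z > 0\<close> unfolding homeomorphism_def by (metis greaterThan_iff image_eqI)
  have "M (x + edir 1) w ** L x w = L (x + edir 2) w ** M x w"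
    using assms(2) w(1) by (simp add: compatible_def)
  then show "M' (x + edir 1) z ** L' x z = L' (x + edir 2) z ** M' x z"
    using *[OF w(1)] by (simp add: w(2) gauge_product inv add.assoc add.commute[of "edir 2" "edir 1"])
qed

text \<open>
  The product of the two transport matrices along one edge of the diagonal net, with \<open>z\<close> for the
  squared spectral parameter and labels \<open>\<alpha>\<^sup>1 = 1/a\<close>, \<open>\<alpha>\<^sup>3 = a\<close>; the values of the map \<open>s\<close> at
  the end points of the edge are \<open>s\<close> and \<open>w\<close>, and \<open>u\<close> is its value at the vertex in between.
\<close>

definition lax_step :: "complex \<Rightarrow> complex \<Rightarrow> complex \<Rightarrow> complex \<Rightarrow> real \<Rightarrow> complex ^ 2 ^ 2" where
  "lax_step a s u w z =
     mat2 (of_real z - w / (s * of_real z)) (u * (a * w + s / a))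
          (- (a / w + 1 / (a * s)) / u) (of_real z - s / (w * of_real z))"

text \<open>The lattice side of the gauge, written in the data of a net alone, so that it is
  available before any lattice has been constructed.\<close>

definition stair_matrix ::
    "(int ^ 2 \<Rightarrow> complex) \<Rightarrow> (2 \<Rightarrow> int ^ 2 \<Rightarrow> complex) \<Rightarrow> (int ^ 2 \<Rightarrow> complex) \<Rightarrow> 2 \<Rightarrow> lax_matrix" where
  "stair_matrix r t l k x =
     lax_step (t k x) (alternate x (r x)) (alternate x (1 / l x)) (alternate (x + edir k) (r (x + edir k)))"

text \<open>Exactly one end of each edge is odd, so either the rows or the columns of a step matrix
  are interchanged, never both. This moves the entries with the spectral parameter off the diagonal,
  and the factors \<i> are placed so that they end up in front of exactly these entries.\<close>

definition swap_gauge :: "int ^ 2 \<Rightarrow> complex ^ 2 ^ 2" where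
  "swap_gauge x = (if even (x $ 1 + x $ 2) then mat2 (- \<i>) 0 0 1 else mat2 0 \<i> 1 0)"

lemma matrix_inv_swap_gauge:
  "matrix_inv (swap_gauge x) = (if even (x $ 1 + x $ 2) then mat2 \<i> 0 0 1 else mat2 0 1 (- \<i>) 0)"
  by (rule matrix_inv_eqI) (auto simp: swap_gauge_def mat_eq_mat2)

lemma invertible_swap_gauge: "invertible (swap_gauge x)"
  unfolding invertible_def
  by (rule exI[of _ "if even (x $ 1 + x $ 2) then mat2 \<i> 0 0 1 else mat2 0 1 (- \<i>) 0"])
    (auto simp: swap_gauge_def mat_eq_mat2)

lemma even_shift:
  "even ((x + edir k) $ 1 + (x + edir k) $ 2) \<longleftrightarrow> odd (x $ 1 + (x :: int ^ 2) $ 2)"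
  using exhaust_2[of k] by (auto simp: axis_def)

lemma K_net_matrix_gauge:
  assumes "\<And>x. r x \<noteq> 0" "\<And>i x. t i x \<noteq> 0" "\<And>x. l x \<noteq> 0" "z > 0"
  shows "K_net_matrix r t l k x z = mat (if even (x $ 1 + x $ 2) then 1 else - 1) **
           (swap_gauge (x + edir k) ** stair_matrix r t l k x z ** matrix_inv (swap_gauge x))"
proof (cases "even (x $ 1 + x $ 2)")
  case True
  then have "swap_gauge (x + edir k) = mat2 0 \<i> 1 0"
    "alternate x y = y" "alternate (x + edir k) y = 1 / y" for y
    unfolding swap_gauge_def alternate_def even_shift by simp_all
  moreover have "matrix_inv (swap_gauge x) = mat2 \<i> 0 0 1"
    unfolding matrix_inv_swap_gauge using True by simp
  ultimately show ?thesis
    using True assms(1)[of x] assms(1)[of "x + edir k"] assms(2)[of k x] assms(3)[of x] \<open>z > 0\<close>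
    unfolding K_net_matrix_def stair_matrix_def lax_step_def
    by (simp add: mat_eq_mat2 field_simps)
next
  case False
  then have "swap_gauge (x + edir k) = mat2 (- \<i>) 0 0 1"
    "alternate x y = 1 / y" "alternate (x + edir k) y = y" for y
    unfolding swap_gauge_def alternate_def even_shift by simp_all
  moreover have "matrix_inv (swap_gauge x) = mat2 0 1 (- \<i>) 0"
    unfolding matrix_inv_swap_gauge using False by simp
  ultimately show ?thesis
    using False assms(1)[of x] assms(1)[of "x + edir k"] assms(2)[of k x] assms(3)[of x] \<open>z > 0\<close>
    unfolding K_net_matrix_def stair_matrix_def lax_step_def
    by (simp add: mat_eq_mat2 field_simps)
qed

lemma gauge_transformable_K_net:
  assumes "\<And>x. r x \<noteq> 0" "\<And>i x. t i x \<noteq> 0" "\<And>x. l x \<noteq> 0" "\<And>x. m x \<noteq> 0"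
    and "homeomorphism {0<..} {0<..} \<phi> \<psi>"
    and "\<And>x z. z > 0 \<Longrightarrow> L x z = stair_matrix r t l 1 x (\<phi> z)"
    and "\<And>x z. z > 0 \<Longrightarrow> M x z = stair_matrix r t m 2 x (\<phi> z)"
  shows "gauge_transformable (L, M) (K_net_matrix r t l 1, K_net_matrix r t m 2)"
proof -
  \<comment> \<open>The sign depends only on the parity of the initial vertex, and
    \<open>x + edir 1\<close> and \<open>x + edir 2\<close> have equal parity; so it cancels in the
    compatibility condition.\<close>
  define c :: "int ^ 2 \<Rightarrow> real \<Rightarrow> complex" where "c x z = (if even (x $ 1 + x $ 2) then 1 else - 1)" for x z
  have pos: "\<phi> z > 0" if "z > 0" for z
    using assms(5) that unfolding homeomorphism_def by auto
  show ?thesis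
    unfolding gauge_transformable_def prod.case
  proof (intro exI conjI allI impI)
    show "homeomorphism {0<..} {0<..} \<phi> \<psi>" by fact
    show "invertible (swap_gauge x)" for x
      by (rule invertible_swap_gauge)
    fix x and z :: real assume "z > 0"
    show "c x z \<noteq> 0" "c x z \<noteq> 0" "c (x + edir 1) z * c x z = c (x + edir 2) z * c x z"
      unfolding c_def even_shift by simp_all
    show "K_net_matrix r t l 1 x (\<phi> z) =
        mat (c x z) ** (swap_gauge (x + edir 1) ** L x z ** matrix_inv (swap_gauge x))"
      "K_net_matrix r t m 2 x (\<phi> z) =
        mat (c x z) ** (swap_gauge (x + edir 2) ** M x z ** matrix_inv (swap_gauge x))"
      using \<open>z > 0\<close> pos assms by (simp_all add: K_net_matrix_gauge c_def)
  qed
qed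

text \<open>A product of two transport matrices depends on the spectral parameter only through its
  square, which becomes the parameter of the net.\<close>

lemma homeomorphism_square: "homeomorphism {0<..} {0<..} (\<lambda>z :: real. z\<^sup>2) sqrt"
  unfolding homeomorphism_def
proof (intro conjI ballI)
  show "(\<lambda>z :: real. z\<^sup>2) ` {0<..} = {0<..}"
  proof (intro equalityI subsetI)
    show "z \<in> (\<lambda>z. z\<^sup>2) ` {0<..}" if "z \<in> {0<..}" for z :: real
      using that by (intro image_eqI[of _ _ "sqrt z"]) auto
  qed auto
  show "sqrt ` {0<..} = {0<..}"
  proof (intro equalityI subsetI)
    show "z \<in> sqrt ` {0<..}" if "z \<in> {0<..}" for z :: real
      using that by (intro image_eqI[of _ _ "z\<^sup>2"]) auto
  qed auto
qed (auto intro!: continuous_intros)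

text \<open>Conjugation inverts the unitary \<open>r\<close> and \<open>t\<close>, so the
  off-diagonal entries fit by themselves and only the diagonal ones have to be compared. The
  right-hand side is this comparison in lattice variables; set against the quad equation with fourth
  value \<open>v\<close>, it amounts to \<open>u * cnj v = 1\<close>.\<close>

lemma quaternionic_K_net_iff:
  assumes "norm (r x) = 1" "norm (r (x + edir k)) = 1" "norm (t k x) = 1" "l x \<noteq> 0" "z > 0"
    and "s = alternate x (r x)" "u = alternate x (1 / l x)"
    and "w = alternate (x + edir k) (r (x + edir k))"
  shows "quaternionic (K_net_matrix r t l k x z) \<longleftrightarrow>
     t k x * s + w / t k x = u * cnj u * (s / t k x + t k x * w)"
proof -
  have cnj: "cnj v = 1 / v" if "norm v = 1" for v :: complex
    using that by (metis complex_div_cnj complex_norm_square div_by_1 mult_1 of_real_1 power_one)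
  have nz: "r x \<noteq> 0" "r (x + edir k) \<noteq> 0" "t k x \<noteq> 0"
    using assms by auto
  have quat: "quaternionic (mat2 a b c d) \<longleftrightarrow> c = - cnj b \<and> d = cnj a" for a b c d
    by (auto simp: quaternionic_def)
  have "(1 / l x) * (t k x / r (x + edir k) + r x / t k x) = cnj (l x) * (t k x * r x + 1 / (t k x * r (x + edir k))) \<longleftrightarrow>
    quaternionic (K_net_matrix r t l k x z)"
  proof -
    have "1 / t k x * (r x / l x) + t k x * (1 / (l x * r (x + edir k))) =
        (1 / l x) * (t k x / r (x + edir k) + r x / t k x)"
      using nz assms(4) by (simp add: field_simps)
    moreover have "cnj (1 / t k x * (l x / r x) + t k x * l x * r (x + edir k)) =
        cnj (l x) * (t k x * r x + 1 / (t k x * r (x + edir k)))"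
      using nz by (simp add: cnj[OF assms(1)] cnj[OF assms(2)] cnj[OF assms(3)] field_simps)
    moreover have "\<i> * (of_real z - 1 / (of_real z * r x * r (x + edir k))) =
        - cnj (\<i> * (of_real z - r x * r (x + edir k) / of_real z))"
      using nz assms(5) by (simp add: cnj[OF assms(1)] cnj[OF assms(2)] field_simps)
    ultimately show ?thesis
      unfolding K_net_matrix_def quat by auto
  qed
  moreover have "t k x * s + w / t k x = u * cnj u * (s / t k x + t k x * w) \<longleftrightarrow>
     (1 / l x) * (t k x / r (x + edir k) + r x / t k x) = cnj (l x) * (t k x * r x + 1 / (t k x * r (x + edir k)))"
  proof (cases "even (x $ 1 + x $ 2)")
    case True
    then have "s = r x" "u = 1 / l x" "w = 1 / r (x + edir k)"
      unfolding assms(6-8) alternate_def even_shift by simp_all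
    then have "t k x * s + w / t k x = t k x * r x + 1 / (t k x * r (x + edir k))" (is "_ = ?X")
      "s / t k x + t k x * w = t k x / r (x + edir k) + r x / t k x" (is "_ = ?Y")
      "u * cnj u = 1 / (l x * cnj (l x))"
      by simp_all
    moreover have "X = 1 / (l x * cnj (l x)) * Y \<longleftrightarrow> 1 / l x * Y = cnj (l x) * X" for X Y
      using assms(4) by (auto simp: field_simps)
    ultimately show ?thesis
      by metis
  next
    case False
    then have "s = 1 / r x" "u = l x" "w = r (x + edir k)"
      unfolding assms(6-8) alternate_def even_shift by simp_all
    \<comment> \<open>At odd vertices the two sums exchange their roles, up to the common factor
      \<open>r (x + edir k) / r x\<close>; as \<open>u * cnj u\<close> is inverted too, the
      condition stays the same.\<close>
    then have "t k x * s + w / t k x = r (x + edir k) / r x * (t k x / r (x + edir k) + r x / t k x)" (is "_ = _ * ?Y")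
      "s / t k x + t k x * w = r (x + edir k) / r x * (t k x * r x + 1 / (t k x * r (x + edir k)))" (is "_ = _ * ?X")
      "u * cnj u = l x * cnj (l x)"
      using nz by (simp_all add: field_simps)
    moreover have "q * Y = l x * cnj (l x) * (q * X) \<longleftrightarrow> 1 / l x * Y = cnj (l x) * X" if "q \<noteq> 0" for q X Y
      using assms(4) that by (auto simp: field_simps)
    moreover have "r (x + edir k) / r x \<noteq> 0"
      using nz by simp
    ultimately show ?thesis
      by metis
  qed
  ultimately show ?thesis by blast
qed

section \<open>The cross-ratio equation and its consistency\<close>

text \<open>
  For \<open>d\<^sup>i = \<alpha>\<^sup>i s\<^sub>i s\<close> the cross-ratios are right automatically, so the equation of a quad is the
  closing condition \<open>d\<^sup>i + d\<^sup>j\<^sub>i = d\<^sup>j + d\<^sup>i\<^sub>j\<close>. Reversing a direction changes the sign of its label;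
  with this convention one lemma on cubes serves for all orientations.
\<close>

definition quad :: "complex \<Rightarrow> complex \<Rightarrow> complex \<Rightarrow> complex \<Rightarrow> complex \<Rightarrow> complex \<Rightarrow> bool" where
  "quad a b s s\<^sub>i s\<^sub>j s\<^sub>i\<^sub>j \<longleftrightarrow> b * (s\<^sub>i\<^sub>j * s\<^sub>i - s * s\<^sub>j) = a * (s\<^sub>i\<^sub>j * s\<^sub>j - s * s\<^sub>i)"

text \<open>The inequalities say that opposite points differ and that the quad can be solved for any
  of its vertices. Listing all four makes the predicate invariant under exchanging and reversing
  directions, without reference to the quad equation.\<close>

definition nondeg :: "complex \<Rightarrow> complex \<Rightarrow> complex \<Rightarrow> complex \<Rightarrow> complex \<Rightarrow> complex \<Rightarrow> bool" where
  "nondeg a b s s\<^sub>i s\<^sub>j s\<^sub>i\<^sub>j \<longleftrightarrow> s \<noteq> 0 \<and> s\<^sub>i \<noteq> 0 \<and> s\<^sub>j \<noteq> 0 \<and> s\<^sub>i\<^sub>j \<noteq> 0 \<and>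
     b * s\<^sub>j \<noteq> a * s\<^sub>i \<and> b * s\<^sub>i \<noteq> a * s\<^sub>j \<and> a * s + b * s\<^sub>i\<^sub>j \<noteq> 0 \<and> b * s + a * s\<^sub>i\<^sub>j \<noteq> 0"

text \<open>The quad equation solved for \<open>s\<^sub>j\<close>. Next to a staircase that ascends
  in both directions, every missing vertex is of this kind.\<close>

definition sideways :: "complex \<Rightarrow> complex \<Rightarrow> complex \<Rightarrow> complex \<Rightarrow> complex \<Rightarrow> complex" where
  "sideways a b s s\<^sub>i s\<^sub>i\<^sub>j = s\<^sub>i * (a * s + b * s\<^sub>i\<^sub>j) / (b * s + a * s\<^sub>i\<^sub>j)"

lemma quad_swap: "quad a b s s\<^sub>i s\<^sub>j s\<^sub>i\<^sub>j \<longleftrightarrow> quad b a s s\<^sub>j s\<^sub>i s\<^sub>i\<^sub>j"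
  by (auto simp: quad_def)

lemma nondeg_swap: "nondeg a b s s\<^sub>i s\<^sub>j s\<^sub>i\<^sub>j \<longleftrightarrow> nondeg b a s s\<^sub>j s\<^sub>i s\<^sub>i\<^sub>j"
  by (auto simp: nondeg_def)

lemma quad_flip: "quad (- a) b s\<^sub>i s s\<^sub>i\<^sub>j s\<^sub>j \<longleftrightarrow> quad a b s s\<^sub>i s\<^sub>j s\<^sub>i\<^sub>j"
  unfolding quad_def by (simp add: algebra_simps) (metis add.commute)

lemma quad_flip': "quad a (- b) s\<^sub>j s\<^sub>i\<^sub>j s s\<^sub>i \<longleftrightarrow> quad a b s s\<^sub>i s\<^sub>j s\<^sub>i\<^sub>j"
  by (metis quad_flip quad_swap)

lemma nondeg_flip: "nondeg (- a) b s\<^sub>i s s\<^sub>i\<^sub>j s\<^sub>j \<longleftrightarrow> nondeg a b s s\<^sub>i s\<^sub>j s\<^sub>i\<^sub>j"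
proof -
  have "b * s\<^sub>i\<^sub>j \<noteq> - a * s \<longleftrightarrow> a * s + b * s\<^sub>i\<^sub>j \<noteq> 0" "b * s \<noteq> - a * s\<^sub>i\<^sub>j \<longleftrightarrow> b * s + a * s\<^sub>i\<^sub>j \<noteq> 0"
    by (simp_all add: eq_neg_iff_add_eq_0 add.commute)
  moreover have "- a * s\<^sub>i + b * s\<^sub>j \<noteq> 0 \<longleftrightarrow> b * s\<^sub>j \<noteq> a * s\<^sub>i" "b * s\<^sub>i + - a * s\<^sub>j \<noteq> 0 \<longleftrightarrow> b * s\<^sub>i \<noteq> a * s\<^sub>j"
    by simp_all
  ultimately show ?thesis
    unfolding nondeg_def by blast
qed

lemma nondeg_flip': "nondeg a (- b) s\<^sub>j s\<^sub>i\<^sub>j s s\<^sub>i \<longleftrightarrow> nondeg a b s s\<^sub>i s\<^sub>j s\<^sub>i\<^sub>j"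
  by (metis nondeg_flip nondeg_swap)

text \<open>A vanishing denominator would make the quotient 0, so a nonzero value certifies that the
  equation has been solved.\<close>

lemma quad_sideways:
  assumes "sideways a b s s\<^sub>i s\<^sub>i\<^sub>j \<noteq> 0"
  shows "quad a b s s\<^sub>i (sideways a b s s\<^sub>i s\<^sub>i\<^sub>j) s\<^sub>i\<^sub>j"
proof -
  have "b * s + a * s\<^sub>i\<^sub>j \<noteq> 0"
    using assms by (auto simp: sideways_def)
  then have "sideways a b s s\<^sub>i s\<^sub>i\<^sub>j * (b * s + a * s\<^sub>i\<^sub>j) = s\<^sub>i * (a * s + b * s\<^sub>i\<^sub>j)"
    by (simp add: sideways_def)
  then show ?thesis
    unfolding quad_def by algebra
qed

text \<open>Eliminating the three faces at \<open>s\<close> from the top face leaves the relation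
  \<open>s\<^sub>1\<^sub>2\<^sub>3 * K = T\<close> among
  \<open>s\<^sub>1, s\<^sub>2, s\<^sub>3, s\<^sub>1\<^sub>2\<^sub>3\<close> alone, the tetrahedron
  property. A permutation of the directions multiplies \<open>K\<close> and \<open>T\<close> by the
  same sign, so the relation is symmetric and contains the other faces as well.\<close>

lemma cube_half:
  assumes bottom: "quad a b s s\<^sub>1 s\<^sub>2 s\<^sub>1\<^sub>2"
    and "quad a c s s\<^sub>1 s\<^sub>3 s\<^sub>1\<^sub>3" "quad b c s s\<^sub>2 s\<^sub>3 s\<^sub>2\<^sub>3"
    and top: "quad a b s\<^sub>3 s\<^sub>1\<^sub>3 s\<^sub>2\<^sub>3 s\<^sub>1\<^sub>2\<^sub>3"
    and "nondeg a b s s\<^sub>1 s\<^sub>2 s\<^sub>1\<^sub>2" "nondeg a c s s\<^sub>1 s\<^sub>3 s\<^sub>1\<^sub>3" "nondeg b c s s\<^sub>2 s\<^sub>3 s\<^sub>2\<^sub>3"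
  shows "quad a c s\<^sub>2 s\<^sub>1\<^sub>2 s\<^sub>2\<^sub>3 s\<^sub>1\<^sub>2\<^sub>3"
proof -
  define D12 D13 D23 where D: "D12 = b * s\<^sub>1 - a * s\<^sub>2" "D13 = c * s\<^sub>1 - a * s\<^sub>3" "D23 = c * s\<^sub>2 - b * s\<^sub>3"
  have nz: "D12 \<noteq> 0" "D13 \<noteq> 0" "D23 \<noteq> 0" "s \<noteq> 0" "s\<^sub>3 \<noteq> 0"
    using assms(5-7) by (auto simp: nondeg_def D)
  have e12: "s\<^sub>1\<^sub>2 * D12 = s * (b * s\<^sub>2 - a * s\<^sub>1)"
    using bottom unfolding quad_def D by algebra
  have e13: "s\<^sub>1\<^sub>3 * D13 = s * (c * s\<^sub>3 - a * s\<^sub>1)"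
    using assms(2) unfolding quad_def D by algebra
  have e23: "s\<^sub>2\<^sub>3 * D23 = s * (c * s\<^sub>3 - b * s\<^sub>2)"
    using assms(3) unfolding quad_def D by algebra
  have et: "s\<^sub>1\<^sub>2\<^sub>3 * (b * s\<^sub>1\<^sub>3 - a * s\<^sub>2\<^sub>3) = s\<^sub>3 * (b * s\<^sub>2\<^sub>3 - a * s\<^sub>1\<^sub>3)"
    using top unfolding quad_def by algebra
  define K T where KT: "K = b * (c\<^sup>2 - a\<^sup>2) * s\<^sub>2 + c * (a\<^sup>2 - b\<^sup>2) * s\<^sub>3 + a * (b\<^sup>2 - c\<^sup>2) * s\<^sub>1"
    "T = b * (c\<^sup>2 - a\<^sup>2) * s\<^sub>1 * s\<^sub>3 + a * (b\<^sup>2 - c\<^sup>2) * s\<^sub>2 * s\<^sub>3 + c * (a\<^sup>2 - b\<^sup>2) * s\<^sub>1 * s\<^sub>2"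
  have "b * (s\<^sub>1\<^sub>3 * D13) * D23 - a * (s\<^sub>2\<^sub>3 * D23) * D13 = s * s\<^sub>3 * K"
    unfolding e13 e23 unfolding KT D by algebra
  moreover have "s\<^sub>3 * (b * (s\<^sub>2\<^sub>3 * D23) * D13 - a * (s\<^sub>1\<^sub>3 * D13) * D23) = s * s\<^sub>3 * T"
    unfolding e13 e23 unfolding KT D by algebra
  moreover have "s\<^sub>1\<^sub>2\<^sub>3 * (b * (s\<^sub>1\<^sub>3 * D13) * D23 - a * (s\<^sub>2\<^sub>3 * D23) * D13) =
      s\<^sub>3 * (b * (s\<^sub>2\<^sub>3 * D23) * D13 - a * (s\<^sub>1\<^sub>3 * D13) * D23)"
    using et by algebra
  ultimately have "s * s\<^sub>3 * (s\<^sub>1\<^sub>2\<^sub>3 * K) = s * s\<^sub>3 * T"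
    by (simp add: algebra_simps)
  then have tetrahedron: "s\<^sub>1\<^sub>2\<^sub>3 * K = T"
    using nz by simp
  have "c * (s\<^sub>1\<^sub>2 * D12) * D23 - a * (s\<^sub>2\<^sub>3 * D23) * D12 = s * s\<^sub>2 * K"
    unfolding e12 e23 unfolding KT D by algebra
  moreover have "s\<^sub>2 * (c * (s\<^sub>2\<^sub>3 * D23) * D12 - a * (s\<^sub>1\<^sub>2 * D12) * D23) = s * s\<^sub>2 * T"
    unfolding e12 e23 unfolding KT D by algebra
  ultimately have "D12 * D23 * (s\<^sub>1\<^sub>2\<^sub>3 * (c * s\<^sub>1\<^sub>2 - a * s\<^sub>2\<^sub>3)) = D12 * D23 * (s\<^sub>2 * (c * s\<^sub>2\<^sub>3 - a * s\<^sub>1\<^sub>2))"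
    using tetrahedron by algebra
  then have "s\<^sub>1\<^sub>2\<^sub>3 * (c * s\<^sub>1\<^sub>2 - a * s\<^sub>2\<^sub>3) = s\<^sub>2 * (c * s\<^sub>2\<^sub>3 - a * s\<^sub>1\<^sub>2)"
    using nz by simp
  then show ?thesis
    unfolding quad_def by algebra
qed

lemma cube:
  assumes "quad a b s s\<^sub>1 s\<^sub>2 s\<^sub>1\<^sub>2" "quad a c s s\<^sub>1 s\<^sub>3 s\<^sub>1\<^sub>3" "quad b c s s\<^sub>2 s\<^sub>3 s\<^sub>2\<^sub>3"
    and "quad a b s\<^sub>3 s\<^sub>1\<^sub>3 s\<^sub>2\<^sub>3 s\<^sub>1\<^sub>2\<^sub>3"
    and "nondeg a b s s\<^sub>1 s\<^sub>2 s\<^sub>1\<^sub>2" "nondeg a c s s\<^sub>1 s\<^sub>3 s\<^sub>1\<^sub>3" "nondeg b c s s\<^sub>2 s\<^sub>3 s\<^sub>2\<^sub>3"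
  shows "quad a c s\<^sub>2 s\<^sub>1\<^sub>2 s\<^sub>2\<^sub>3 s\<^sub>1\<^sub>2\<^sub>3 \<and> quad b c s\<^sub>1 s\<^sub>1\<^sub>2 s\<^sub>1\<^sub>3 s\<^sub>1\<^sub>2\<^sub>3"
  using cube_half[OF assms] cube_half[of b a s s\<^sub>2 s\<^sub>1 s\<^sub>1\<^sub>2 c s\<^sub>3 s\<^sub>2\<^sub>3 s\<^sub>1\<^sub>3 s\<^sub>1\<^sub>2\<^sub>3] assms
    quad_swap nondeg_swap by blast

section \<open>Extending values from a staircase to a plane\<close>

function stair_ext ::
    "(int \<Rightarrow> complex) \<Rightarrow> (int \<Rightarrow> complex) \<Rightarrow> (int \<Rightarrow> complex) \<Rightarrow> (int \<Rightarrow> complex) \<Rightarrow> int \<Rightarrow> int \<Rightarrow> complex" where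
  "stair_ext A B g h a b =
     (if a = b then g b else if a = b + 1 then h b
      else if a > b + 1 then
        sideways (B b) (A (a - 1)) (stair_ext A B g h (a - 1) b)
          (stair_ext A B g h (a - 1) (b + 1)) (stair_ext A B g h a (b + 1))
      else
        sideways (A a) (B (b - 1)) (stair_ext A B g h a (b - 1))
          (stair_ext A B g h (a + 1) (b - 1)) (stair_ext A B g h (a + 1) b))"
  by auto
termination
  \<comment> \<open>Twice the distance of \<open>a - b\<close> from 1/2: the staircase consists of
    the diagonals \<open>a - b = 0\<close> and \<open>a - b = 1\<close>, which lie symmetrically
    about 1/2.\<close>
  by (relation "Wellfounded.measure (\<lambda>(A, B, g, h, a, b). nat \<bar>2 * (a - b) - 1\<bar>)") auto

declare stair_ext.simps [simp del]

lemma stair_ext_stair [simp]: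
  "stair_ext A B g h b b = g b" "stair_ext A B g h (b + 1) b = h b"
  by (simp_all add: stair_ext.simps)

text \<open>Applied to membership in \<open>propagated\<close>, this makes all extended values
  nonzero, which \<open>stair_ext_quad\<close> presupposes.\<close>

lemma stair_ext_in:
  assumes "\<And>b. P b b (g b)" "\<And>b. P (b + 1) b (h b)"
    and "\<And>a b s s\<^sub>i s\<^sub>i\<^sub>j. P a b s \<Longrightarrow> P (a + 1) b s\<^sub>i \<Longrightarrow> P (a + 1) (b + 1) s\<^sub>i\<^sub>j \<Longrightarrow>
           P a (b + 1) (sideways (A a) (B b) s s\<^sub>i s\<^sub>i\<^sub>j)"
    and "\<And>a b s s\<^sub>j s\<^sub>i\<^sub>j. P a b s \<Longrightarrow> P a (b + 1) s\<^sub>j \<Longrightarrow> P (a + 1) (b + 1) s\<^sub>i\<^sub>j \<Longrightarrow>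
           P (a + 1) b (sideways (B b) (A a) s s\<^sub>j s\<^sub>i\<^sub>j)"
  shows "P a b (stair_ext A B g h a b)"
  using assms
proof (induction A B g h a b rule: stair_ext.induct)
  case (1 A B g h a b)
  note IH = 1(1-6)[OF _ _ _ 1(7-10)]
  consider "a = b" | "a = b + 1" | "a > b + 1" | "a < b" by linarith
  then show ?case
  proof cases
    case 3
    have "P (a - 1 + 1) b (sideways (B b) (A (a - 1)) (stair_ext A B g h (a - 1) b)
          (stair_ext A B g h (a - 1) (b + 1)) (stair_ext A B g h a (b + 1)))"
      using 3 IH(1-3) by (intro 1(10)) auto
    then show ?thesis
      using 3 by (subst stair_ext.simps) simp
  next
    case 4
    have "P a (b - 1 + 1) (sideways (A a) (B (b - 1)) (stair_ext A B g h a (b - 1))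
          (stair_ext A B g h (a + 1) (b - 1)) (stair_ext A B g h (a + 1) b))"
      using 4 IH(4-6) by (intro 1(9)) auto
    then show ?thesis
      using 4 by (subst stair_ext.simps) simp
  qed (use 1(7,8) in \<open>auto simp: stair_ext.simps\<close>)
qed

text \<open>Each quad of the plane is the one from which its vertex farthest from the staircase was
  computed: \<open>(a + 1, b)\<close> if \<open>a > b\<close>, and \<open>(a, b + 1)\<close>
  otherwise.\<close>

lemma stair_ext_quad:
  assumes "\<And>a b. stair_ext A B g h a b \<noteq> 0"
  shows "quad (A a) (B b) (stair_ext A B g h a b) (stair_ext A B g h (a + 1) b)
           (stair_ext A B g h a (b + 1)) (stair_ext A B g h (a + 1) (b + 1))"
proof (cases "a > b")
  case True
  then have "stair_ext A B g h (a + 1) b = sideways (B b) (A a) (stair_ext A B g h a b)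
      (stair_ext A B g h a (b + 1)) (stair_ext A B g h (a + 1) (b + 1))"
    by (subst stair_ext.simps) simp
  then show ?thesis
    by (metis assms quad_sideways quad_swap)
next
  case False
  then have "stair_ext A B g h a (b + 1) = sideways (A a) (B b) (stair_ext A B g h a b)
      (stair_ext A B g h (a + 1) b) (stair_ext A B g h (a + 1) (b + 1))"
    by (subst stair_ext.simps) simp
  then show ?thesis
    by (metis assms quad_sideways)
qed

text \<open>
  By induction on the distance \<open>a - b\<close> from the staircase: each cube over a quad of the plane
  carries the equation from two of its vertical faces to the two opposite ones.
\<close>

lemma vertical_quads:
  fixes u v :: "int \<Rightarrow> int \<Rightarrow> complex"
  assumes Qu: "\<And>a b. quad (A a) (B b) (u a b) (u (a + 1) b) (u a (b + 1)) (u (a + 1) (b + 1))"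
    and Qv: "\<And>a b. quad (A a) (B b) (v a b) (v (a + 1) b) (v a (b + 1)) (v (a + 1) (b + 1))"
    and Nu: "\<And>a b. nondeg (A a) (B b) (u a b) (u (a + 1) b) (u a (b + 1)) (u (a + 1) (b + 1))"
    and NA: "\<And>a b. nondeg (A a) c (u a b) (u (a + 1) b) (v a b) (v (a + 1) b)"
    and NB: "\<And>a b. nondeg (B b) c (u a b) (u a (b + 1)) (v a b) (v a (b + 1))"
    and "\<And>n. quad (A n) c (u n n) (u (n + 1) n) (v n n) (v (n + 1) n)"
    and "\<And>n. quad (B n) c (u (n + 1) n) (u (n + 1) (n + 1)) (v (n + 1) n) (v (n + 1) (n + 1))"
  shows "quad (A a) c (u a b) (u (a + 1) b) (v a b) (v (a + 1) b) \<and>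
    quad (B b) c (u a b) (u a (b + 1)) (v a b) (v a (b + 1))"
proof -
  let ?A = "\<lambda>a b. quad (A a) c (u a b) (u (a + 1) b) (v a b) (v (a + 1) b)"
  let ?B = "\<lambda>a b. quad (B b) c (u a b) (u a (b + 1)) (v a b) (v a (b + 1))"
  \<comment> \<open>The two known vertical faces meet over \<open>(a, b + 1)\<close>. The cube is
    based there, with the second direction reversed and its label negated; \<open>down\<close> does
    the same over \<open>(a + 1, b)\<close>.\<close>
  have up: "?A a b \<and> ?B (a + 1) b" if "?A a (b + 1)" "?B a b" for a b
    using cube[of "A a" "- B b" "u a (b + 1)" "u (a + 1) (b + 1)" "u a b" "u (a + 1) b" c
        "v a (b + 1)" "v (a + 1) (b + 1)" "v a b" "v (a + 1) b"]
      Qu[of a b] Qv[of a b] Nu[of a b] NA[of a "b + 1"] NB[of b a] that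
    by (simp add: quad_flip quad_flip' nondeg_flip nondeg_flip')
  have down: "?A a (b + 1) \<and> ?B a b" if "?A a b" "?B (a + 1) b" for a b
    using cube[of "- A a" "B b" "u (a + 1) b" "u a b" "u (a + 1) (b + 1)" "u a (b + 1)" c
        "v (a + 1) b" "v a b" "v (a + 1) (b + 1)" "v a (b + 1)"]
      Qu[of a b] Qv[of a b] Nu[of a b] NA[of a b] NB[of b "a + 1"] that
    by (simp add: quad_flip quad_flip' nondeg_flip nondeg_flip')
  \<comment> \<open>For fixed \<open>k\<close> these are the faces over a translate of the
    staircase, and \<open>k = 0\<close> is the given one.\<close>
  have *: "\<forall>b. ?A (b + k) b \<and> ?B (b + k + 1) b" for k
  proof (induction k rule: int_induct[where k = 0])
    case base
    show ?case using assms(6,7) by simp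
  next
    case (step1 k)
    show ?case
    proof
      fix b
      have "?A (b + 1 + k) (b + 1)" "?B (b + k + 1) b"
        using step1(2) by blast+
      then show "?A (b + (k + 1)) b \<and> ?B (b + (k + 1) + 1) b"
        using up[of "b + k + 1" b] by (simp add: algebra_simps)
    qed
  next
    case (step2 k)
    show ?case
    proof
      fix b
      have "?A (b - 1 + k) (b - 1)" "?B (b + k + 1) b" "?A (b + k) b" "?B (b - 1 + k + 1) (b - 1)"
        using step2(2) by blast+
      then show "?A (b + (k - 1)) b \<and> ?B (b + (k - 1) + 1) b"
        using down[of "b - 1 + k" "b - 1"] down[of "b + k" b] by (simp add: algebra_simps)
    qed
  qed
  show ?thesis
    using *[rule_format, of b "a - b"] *[rule_format, of b "a - b - 1"] by (simp add: algebra_simps)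
qed

text \<open>\<open>cube_half\<close> with the second and third directions exchanged, read as moving
  the equation of a face to the opposite face.\<close>

lemma quad_transport:
  assumes "quad a c s s\<^sub>1 s\<^sub>3 s\<^sub>1\<^sub>3" "quad b c s s\<^sub>2 s\<^sub>3 s\<^sub>2\<^sub>3"
    "quad a c s\<^sub>2 s\<^sub>1\<^sub>2 s\<^sub>2\<^sub>3 s\<^sub>1\<^sub>2\<^sub>3" "quad a b s s\<^sub>1 s\<^sub>2 s\<^sub>1\<^sub>2"
    and "nondeg a b s s\<^sub>1 s\<^sub>2 s\<^sub>1\<^sub>2" "nondeg a c s s\<^sub>1 s\<^sub>3 s\<^sub>1\<^sub>3" "nondeg b c s s\<^sub>2 s\<^sub>3 s\<^sub>2\<^sub>3"
  shows "quad a b s\<^sub>3 s\<^sub>1\<^sub>3 s\<^sub>2\<^sub>3 s\<^sub>1\<^sub>2\<^sub>3"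
  using cube_half[of a c s s\<^sub>1 s\<^sub>3 s\<^sub>1\<^sub>3 b s\<^sub>2 s\<^sub>1\<^sub>2 s\<^sub>2\<^sub>3 s\<^sub>1\<^sub>2\<^sub>3] assms quad_swap nondeg_swap by blast

section \<open>Compatibility of Lax matrices and quad equations\<close>

text \<open>The upper right entry of the product combines \<open>z\<close> and \<open>1 / z\<close>,
  and two positive parameters separate the two coefficients. In the upper left entry the terms in
  the square of \<open>z\<close> and its inverse agree on both sides, so a single parameter gives
  the constant term.\<close>

lemma lax_step_commute_coeffs:
  assumes "\<And>z. z > 0 \<Longrightarrow> lax_step b s\<^sub>1\<^sub>3 p w z ** lax_step a s s\<^sub>1 s\<^sub>1\<^sub>3 z = lax_step a s\<^sub>2\<^sub>4 q w z ** lax_step b s s\<^sub>2 s\<^sub>2\<^sub>4 z"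
    and nz: "s \<noteq> 0" "s\<^sub>1\<^sub>3 \<noteq> 0" "s\<^sub>2\<^sub>4 \<noteq> 0" "w \<noteq> 0"
    and A: "A = s\<^sub>1 * (a * s\<^sub>1\<^sub>3 + s / a)" "A' = - (a / s\<^sub>1\<^sub>3 + 1 / (a * s)) / s\<^sub>1"
    and C: "C = s\<^sub>2 * (b * s\<^sub>2\<^sub>4 + s / b)" "C' = - (b / s\<^sub>2\<^sub>4 + 1 / (b * s)) / s\<^sub>2"
    and C1: "C1 = p * (b * w + s\<^sub>1\<^sub>3 / b)"
    and A2: "A2 = q * (a * w + s\<^sub>2\<^sub>4 / a)"
  shows "A + C1 = C + A2" "(w * A + s * C1) / s\<^sub>1\<^sub>3 = (w * C + s * A2) / s\<^sub>2\<^sub>4"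
    "C1 * A' - s\<^sub>1\<^sub>3 / s - w / s\<^sub>1\<^sub>3 = A2 * C' - s\<^sub>2\<^sub>4 / s - w / s\<^sub>2\<^sub>4"
proof -
  have e11: "(of_real z - w / (s\<^sub>1\<^sub>3 * of_real z)) * (of_real z - s\<^sub>1\<^sub>3 / (s * of_real z)) + C1 * A' =
      (of_real z - w / (s\<^sub>2\<^sub>4 * of_real z)) * (of_real z - s\<^sub>2\<^sub>4 / (s * of_real z)) + A2 * C'"
    and e12: "(of_real z - w / (s\<^sub>1\<^sub>3 * of_real z)) * A + C1 * (of_real z - s / (s\<^sub>1\<^sub>3 * of_real z)) =
      (of_real z - w / (s\<^sub>2\<^sub>4 * of_real z)) * C + A2 * (of_real z - s / (s\<^sub>2\<^sub>4 * of_real z))" if "z > 0" for z :: real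
    using assms(1)[OF that] unfolding lax_step_def A C C1 A2 mat2_mult mat2_eq_iff by blast+
  show "C1 * A' - s\<^sub>1\<^sub>3 / s - w / s\<^sub>1\<^sub>3 = A2 * C' - s\<^sub>2\<^sub>4 / s - w / s\<^sub>2\<^sub>4"
    using e11[of 1] nz by (simp add: algebra_simps)
  have expand: "(of_real z - w / (s' * of_real z)) * A + C1 * (of_real z - s / (s' * of_real z)) =
      (A + C1) * of_real z - (w * A + s * C1) / s' / of_real z" if "z > 0" "s' \<noteq> 0" for z :: real and s' A C1
    using that nz by (simp add: field_simps)
  have e12': "(A + C1 - C - A2) * (of_real z)\<^sup>2 = (w * A + s * C1) / s\<^sub>1\<^sub>3 - (w * C + s * A2) / s\<^sub>2\<^sub>4" (is "?P * _ = ?Q")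
    if "z > 0" for z :: real
  proof -
    have "?P * of_real z = ?Q / of_real z"
      using e12[OF that] expand[OF that nz(2), of A C1] expand[OF that nz(3), of C A2]
      by (simp add: algebra_simps diff_divide_distrib)
    then show ?thesis
      using that by (simp add: power2_eq_square eq_divide_eq mult.assoc)
  qed
  have P0: "A + C1 - C - A2 = 0"
  proof -
    have "p = 0" if "p * 4 = q" "p * 1 = q" for p q :: complex
      using that by auto
    moreover have "(of_real 2)\<^sup>2 = (4 :: complex)" "(of_real 1)\<^sup>2 = (1 :: complex)"
      by simp_all
    ultimately show ?thesis
      using e12'[of 2] e12'[of 1] by (metis zero_less_numeral zero_less_one)
  qed
  then show "A + C1 = C + A2"
    by (simp add: algebra_simps)
  show "(w * A + s * C1) / s\<^sub>1\<^sub>3 = (w * C + s * A2) / s\<^sub>2\<^sub>4"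
    using e12'[of 1] unfolding P0 by simp
qed

text \<open>
  At \<open>z = \<i>\<alpha>\<^sup>1\<close> the vector \<open>(\<i> s s\<^sub>1, 1)\<close> is in the kernel of \<open>L\<close>, hence of \<open>L\<^sub>2 M\<close>. Up to a
  nonzero factor, the first component of its image under \<open>L\<^sub>2 M\<close> is \<open>(a w + s\<^sub>2\<^sub>4/a) R\<close>.
\<close>

lemma lax_step_commute_quad:
  assumes lax: "\<And>z. z > 0 \<Longrightarrow> lax_step b s\<^sub>1\<^sub>3 p w z ** lax_step a s s\<^sub>1 s\<^sub>1\<^sub>3 z = lax_step a s\<^sub>2\<^sub>4 q w z ** lax_step b s s\<^sub>2 s\<^sub>2\<^sub>4 z"
    and nz: "s \<noteq> 0" "s\<^sub>1\<^sub>3 \<noteq> 0" "s\<^sub>2\<^sub>4 \<noteq> 0" "w \<noteq> 0" "s\<^sub>1 \<noteq> 0" "s\<^sub>2 \<noteq> 0" "a \<noteq> 0" "b \<noteq> 0"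
    and "a * w + s\<^sub>2\<^sub>4 / a \<noteq> 0"
    and "quad (1 / a) (1 / b) s s\<^sub>1 s\<^sub>2 s\<^sub>1\<^sub>2" "nondeg (1 / a) (1 / b) s s\<^sub>1 s\<^sub>2 s\<^sub>1\<^sub>2"
  shows "quad (1 / a) b s\<^sub>2 s\<^sub>1\<^sub>2 s\<^sub>2\<^sub>4 q"
proof -
  define A A' C C' C1 A2 where
    A: "A = s\<^sub>1 * (a * s\<^sub>1\<^sub>3 + s / a)" "A' = - (a / s\<^sub>1\<^sub>3 + 1 / (a * s)) / s\<^sub>1"
    and C: "C = s\<^sub>2 * (b * s\<^sub>2\<^sub>4 + s / b)" "C' = - (b / s\<^sub>2\<^sub>4 + 1 / (b * s)) / s\<^sub>2"
    and C1: "C1 = p * (b * w + s\<^sub>1\<^sub>3 / b)"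
    and A2: "A2 = q * (a * w + s\<^sub>2\<^sub>4 / a)"
  note coeffs = lax_step_commute_coeffs[OF lax nz(1-4) A C C1 A2]
  define R where "R = s\<^sub>2 * (s\<^sub>2 * (b * s\<^sub>2\<^sub>4 + s / b) - s\<^sub>1 * (s / a + a * s\<^sub>2\<^sub>4)) +
    q * ((s\<^sub>2\<^sub>4 / a + a * s) * s\<^sub>2 - (b * s + s\<^sub>2\<^sub>4 / b) * s\<^sub>1)"
  \<comment> \<open>The parameter \<open>\<i> / a\<close> of the kernel argument need not be
    positive, so compatibility cannot be evaluated there. The same combination is formed from the
    coefficient identities instead.\<close>
  have "(a * w + s\<^sub>2\<^sub>4 / a) * R / (s\<^sub>2\<^sub>4 * s\<^sub>2) =
      (1 / a + a * w / s\<^sub>2\<^sub>4) * (C - (1 / a + a * s\<^sub>2\<^sub>4 / s) * s * s\<^sub>1) +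
      A2 * (C' * s * s\<^sub>1 + (1 / a + a * s / s\<^sub>2\<^sub>4))"
    unfolding R_def C A2 using nz by (simp add: field_simps)
  also have "\<dots> = s * s\<^sub>1 * ((A2 * C' - s\<^sub>2\<^sub>4 / s - w / s\<^sub>2\<^sub>4) - 1 / a\<^sup>2 - a\<^sup>2 * w / s) +
      (C + A2) / a + a * ((w * C + s * A2) / s\<^sub>2\<^sub>4)"
    using nz by (simp add: field_simps power2_eq_square)
  also have "\<dots> = s * s\<^sub>1 * ((C1 * A' - s\<^sub>1\<^sub>3 / s - w / s\<^sub>1\<^sub>3) - 1 / a\<^sup>2 - a\<^sup>2 * w / s) +
      (A + C1) / a + a * ((w * A + s * C1) / s\<^sub>1\<^sub>3)"
    by (simp only: coeffs)
  also have "\<dots> = 0"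
    unfolding A using nz by (simp add: field_simps power2_eq_square)
  finally have "R = 0"
    using assms(10) nz by simp
  define D12 where "D12 = s\<^sub>1 / b - s\<^sub>2 / a"
  have e12: "s\<^sub>1\<^sub>2 * D12 = s * (s\<^sub>2 / b - s\<^sub>1 / a)"
    using assms(11) unfolding D12_def quad_def by (simp add: algebra_simps)
  have "D12 \<noteq> 0"
    using assms(12) by (simp add: nondeg_def D12_def)
  \<comment> \<open>Up to the factor \<open>a\<close>, \<open>R\<close> is the claimed equation
    multiplied by \<open>D12\<close>, with \<open>s\<^sub>1\<^sub>2\<close> eliminated.\<close>
  have "(s * (s\<^sub>2 / b - s\<^sub>1 / a)) * (b * q + s\<^sub>2 / a) - D12 * (q * s\<^sub>2\<^sub>4 / a + b * s\<^sub>2 * s\<^sub>2\<^sub>4) = R / a"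
    unfolding D12_def R_def using nz by (simp add: field_simps)
  then have "D12 * (s\<^sub>1\<^sub>2 * (b * q + s\<^sub>2 / a)) = D12 * (q * s\<^sub>2\<^sub>4 / a + b * s\<^sub>2 * s\<^sub>2\<^sub>4)"
    unfolding e12[symmetric] \<open>R = 0\<close> by (simp add: algebra_simps)
  then have "s\<^sub>1\<^sub>2 * (b * q + s\<^sub>2 / a) = q * s\<^sub>2\<^sub>4 / a + b * s\<^sub>2 * s\<^sub>2\<^sub>4"
    using \<open>D12 \<noteq> 0\<close> by simp
  then show ?thesis
    unfolding quad_def by (simp add: algebra_simps)
qed

text \<open>The second equation is the first with the two directions exchanged. The coefficient of
  \<open>z\<close> in the upper right entry is the closing condition along the boundary of the 2 by
  2 block of quads; once three of the quads close, so does the fourth.\<close>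

lemma lax_step_commute_quads:
  assumes lax: "\<And>z. z > 0 \<Longrightarrow> lax_step b s\<^sub>1\<^sub>3 p w z ** lax_step a s s\<^sub>1 s\<^sub>1\<^sub>3 z = lax_step a s\<^sub>2\<^sub>4 q w z ** lax_step b s s\<^sub>2 s\<^sub>2\<^sub>4 z"
    and nz: "s \<noteq> 0" "s\<^sub>1\<^sub>3 \<noteq> 0" "s\<^sub>2\<^sub>4 \<noteq> 0" "w \<noteq> 0" "s\<^sub>1 \<noteq> 0" "s\<^sub>2 \<noteq> 0" "a \<noteq> 0" "b \<noteq> 0"
    and "a * w + s\<^sub>2\<^sub>4 / a \<noteq> 0" "b * w + s\<^sub>1\<^sub>3 / b \<noteq> 0"
    and q12: "quad (1 / a) (1 / b) s s\<^sub>1 s\<^sub>2 s\<^sub>1\<^sub>2" and "nondeg (1 / a) (1 / b) s s\<^sub>1 s\<^sub>2 s\<^sub>1\<^sub>2"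
  shows "quad (1 / a) b s\<^sub>2 s\<^sub>1\<^sub>2 s\<^sub>2\<^sub>4 q" "quad (1 / b) a s\<^sub>1 s\<^sub>1\<^sub>2 s\<^sub>1\<^sub>3 p" "quad a b s\<^sub>1\<^sub>2 p q w"
proof -
  show 1: "quad (1 / a) b s\<^sub>2 s\<^sub>1\<^sub>2 s\<^sub>2\<^sub>4 q"
    by (rule lax_step_commute_quad[OF lax]) (use assms in auto)
  show 2: "quad (1 / b) a s\<^sub>1 s\<^sub>1\<^sub>2 s\<^sub>1\<^sub>3 p"
    by (rule lax_step_commute_quad[OF lax[symmetric]]) (use assms quad_swap nondeg_swap in auto)
  have "s\<^sub>1 * (a * s\<^sub>1\<^sub>3 + s * (1 / a)) + p * (b * w + s\<^sub>1\<^sub>3 * (1 / b)) =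
      s\<^sub>2 * (b * s\<^sub>2\<^sub>4 + s * (1 / b)) + q * (a * w + s\<^sub>2\<^sub>4 * (1 / a))"
    using lax_step_commute_coeffs(1)[OF lax nz(1-4) refl refl refl refl refl refl] by simp
  then show "quad a b s\<^sub>1\<^sub>2 p q w"
    using 1 2 q12 unfolding quad_def by algebra
qed

section \<open>Lattices on the four-dimensional grid\<close>

lemma vector_4 [simp]:
  "(vector [p, q, u, v] :: 'a::zero ^ 4) $ 1 = p" "(vector [p, q, u, v] :: 'a ^ 4) $ 2 = q"
  "(vector [p, q, u, v] :: 'a ^ 4) $ 3 = u" "(vector [p, q, u, v] :: 'a ^ 4) $ 4 = v"
  unfolding vector_def by simp_all

text \<open>\<open>a, b\<close> are the coordinates in the directions \<open>1, 3\<close> and \<open>c, d\<close> those in the directions \<open>2, 4\<close>.\<close>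

definition pt :: "int \<Rightarrow> int \<Rightarrow> int \<Rightarrow> int \<Rightarrow> int ^ 4" where
  "pt a b c d = vector [a, c, b, d]"

lemma pt_nth [simp]: "pt a b c d $ 1 = a" "pt a b c d $ 3 = b" "pt a b c d $ 2 = c" "pt a b c d $ 4 = d"
  by (simp_all add: pt_def)

lemma pt_edir [simp]:
  "pt a b c d + edir 1 = pt (a + 1) b c d" "pt a b c d + edir 3 = pt a (b + 1) c d"
  "pt a b c d + edir 2 = pt a b (c + 1) d" "pt a b c d + edir 4 = pt a b c (d + 1)"
  by (simp_all add: vec_eq_iff forall_4 axis_def)

lemma pt_cases: obtains a b c d where "x = pt a b c d"
proof
  show "x = pt (x $ 1) (x $ 3) (x $ 2) (x $ 4)"
    by (simp add: vec_eq_iff forall_4)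
qed

lemma diagonal_pt: "diagonal x = pt (x $ 1) (x $ 1) (x $ 2) (x $ 2)"
  by (simp add: diagonal_def pt_def)

lemma diagonal_shift:
  "diagonal (x + edir 1) = diagonal x + edir 1 + edir 3"
  "diagonal (x + edir 2) = diagonal x + edir 2 + edir 4"
  by (simp_all add: diagonal_def vec_eq_iff forall_4 axis_def)

lemma int_vec_2_induct:
  fixes x :: "int ^ 2"
  assumes "P 0" "\<And>x k. P (x + edir k) \<longleftrightarrow> P x"
  shows "P x"
proof -
  have shift: "vector [a + 1, b] = (vector [a, b] :: int ^ 2) + edir 1"
    "vector [a, b + 1] = (vector [a, b] :: int ^ 2) + edir 2" for a b
    by (simp_all add: vec_eq_iff forall_2 axis_def)
  have a: "P (vector [a, 0])" for a
  proof (induction a rule: int_induct[where k = 0])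
    case base
    have "vector [0, 0] = (0 :: int ^ 2)"
      by (simp add: vec_eq_iff forall_2)
    then show ?case using assms(1) by simp
  next
    case (step1 a)
    then show ?case by (simp add: shift assms(2))
  next
    case (step2 a)
    then show ?case using shift(1)[of "a - 1" 0] by (simp add: assms(2))
  qed
  have "P (vector [a, b])" for a b
  proof (induction b rule: int_induct[where k = 0])
    case base
    then show ?case by (rule a)
  next
    case (step1 b)
    then show ?case by (simp add: shift assms(2))
  next
    case (step2 b)
    then show ?case using shift(2)[of a "b - 1"] by (simp add: assms(2))
  qed
  moreover have "x = vector [x $ 1, x $ 2]"
    by (simp add: vec_eq_iff forall_2)
  ultimately show ?thesis by metis
qed

lemma alternate_involution [simp]: "alternate x (alternate x y) = y" "alternate x (1 / alternate x (1 / y)) = y"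
  by (auto simp: alternate_def)

text \<open>The equation says that both paths to the opposite point have the same sum. Distinct
  points give one inequality of each kind in \<open>nondeg\<close>, and the equation turns them into
  the remaining two.\<close>

lemma cross_ratio_system_quad:
  assumes "cross_ratio_system f \<alpha>" "\<And>i x. edge_diff f i x = \<alpha> i x * s (x + edir i) * s x" "i \<noteq> j"
  shows "quad (\<alpha> i x) (\<alpha> j x) (s x) (s (x + edir i)) (s (x + edir j)) (s (x + edir i + edir j))"
    "nondeg (\<alpha> i x) (\<alpha> j x) (s x) (s (x + edir i)) (s (x + edir j)) (s (x + edir i + edir j))"
proof -
  have comm: "x + edir j + edir i = x + edir i + edir j"
    by (simp add: algebra_simps)
  have dist: "distinct [f x, f (x + edir i), f (x + edir i + edir j), f (x + edir j)]"
    and \<alpha>: "\<alpha> i (x + edir j) = \<alpha> i x" "\<alpha> j (x + edir i) = \<alpha> j x"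
    using assms(1,3) unfolding cross_ratio_system_def by metis+
  let ?a = "\<alpha> i x" and ?b = "\<alpha> j x"
  let ?s = "s x" and ?si = "s (x + edir i)" and ?sj = "s (x + edir j)" and ?sij = "s (x + edir i + edir j)"
  have f: "f (x + edir i) = f x + ?a * ?si * ?s" "f (x + edir j) = f x + ?b * ?sj * ?s"
    "f (x + edir i + edir j) = f (x + edir i) + ?b * ?sij * ?si"
    "f (x + edir i + edir j) = f (x + edir j) + ?a * ?sij * ?sj"
    using assms(2)[of i x] assms(2)[of j x] assms(2)[of j "x + edir i"] assms(2)[of i "x + edir j"]
    by (simp_all add: edge_diff_def \<alpha> comm algebra_simps)
  show q: "quad ?a ?b ?s ?si ?sj ?sij"
    using f unfolding quad_def by algebra
  have "?s \<noteq> 0" "?si \<noteq> 0" "?sj \<noteq> 0" "?sij \<noteq> 0"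
    using dist f by auto
  moreover have "?b * ?sj \<noteq> ?a * ?si"
    using dist f(1,2) by auto
  moreover have "?a * ?s + ?b * ?sij \<noteq> 0"
  proof
    assume "?a * ?s + ?b * ?sij = 0"
    then have "f (x + edir i + edir j) = f x"
      using f(1,3) by algebra
    then show False using dist by simp
  qed
  moreover have "?sij * (?b * ?si - ?a * ?sj) = ?s * (?b * ?sj - ?a * ?si)"
    "?si * (?a * ?s + ?b * ?sij) = ?sj * (?b * ?s + ?a * ?sij)"
    using q unfolding quad_def by algebra+
  ultimately show "nondeg ?a ?b ?s ?si ?sj ?sij"
    unfolding nondeg_def by auto
qed

lemma transport_product:
  assumes "s \<noteq> 0" "u \<noteq> 0" "w \<noteq> 0" "a \<noteq> 0" "z > 0"
  shows "(z *\<^sub>R mat 1 + (1 / z) *\<^sub>R mat2 0 (a * w * u) (- a\<^sup>2 / (a * w * u)) 0) **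
      (z *\<^sub>R mat 1 + (1 / z) *\<^sub>R mat2 0 (1 / a * u * s) (- (1 / a)\<^sup>2 / (1 / a * u * s)) 0) =
      lax_step a s u w (z\<^sup>2)"
  using assms by (simp add: lax_step_def mat_eq_mat2 field_simps power2_eq_square)

text \<open>Serves both halves of the equivalence: the data of the net may have been read off from
  the lattice, or the lattice constructed from them.\<close>

lemma gauge_transformable_C_minus_K_net:
  assumes edge: "\<And>i x. edge_diff f i x = \<alpha> i x * s (x + edir i) * s x"
    and \<alpha>: "\<And>i j x. i \<noteq> j \<Longrightarrow> \<alpha> i (x + edir j) = \<alpha> i x"
    "\<And>x. \<alpha> 1 (diagonal x) = 1 / t 1 x" "\<And>x. \<alpha> 3 (diagonal x) = t 1 x"
    "\<And>x. \<alpha> 2 (diagonal x) = 1 / t 2 x" "\<And>x. \<alpha> 4 (diagonal x) = t 2 x"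
    and s: "\<And>x. s (diagonal x) = alternate x (r x)" "\<And>x. s (diagonal x + edir 1) = alternate x (1 / l x)"
    "\<And>x. s (diagonal x + edir 2) = alternate x (1 / m x)"
    and nz: "\<And>x. r x \<noteq> 0" "\<And>i x. t i x \<noteq> 0" "\<And>x. l x \<noteq> 0" "\<And>x. m x \<noteq> 0"
  shows "gauge_transformable (C_minus_L f \<alpha>, C_minus_M f \<alpha>) (K_net_matrix r t l 1, K_net_matrix r t m 2)"
proof (rule gauge_transformable_K_net[OF nz homeomorphism_square])
  fix x and z :: real
  assume "z > 0"
  have nz': "alternate x y \<noteq> 0" if "y \<noteq> 0" for x y
    using that by (simp add: alternate_def)
  have "edge_diff f 3 (diagonal x + edir 1) =
      t 1 x * alternate (x + edir 1) (r (x + edir 1)) * alternate x (1 / l x)"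
    "edge_diff f 1 (diagonal x) = 1 / t 1 x * alternate x (1 / l x) * alternate x (r x)"
    "\<alpha> 3 (diagonal x + edir 1) = t 1 x" "\<alpha> 1 (diagonal x) = 1 / t 1 x"
    using \<alpha>(1)[of 3 1 "diagonal x"] by (simp_all add: edge \<alpha>(2-5) s flip: diagonal_shift)
  note eqs = this
  show "C_minus_L f \<alpha> x z = stair_matrix r t l 1 x (z\<^sup>2)"
    unfolding C_minus_L_def transport_def p_matrix_def stair_matrix_def eqs
    by (rule transport_product) (simp_all add: nz nz' \<open>z > 0\<close>)
  have "edge_diff f 4 (diagonal x + edir 2) =
      t 2 x * alternate (x + edir 2) (r (x + edir 2)) * alternate x (1 / m x)"
    "edge_diff f 2 (diagonal x) = 1 / t 2 x * alternate x (1 / m x) * alternate x (r x)"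
    "\<alpha> 4 (diagonal x + edir 2) = t 2 x" "\<alpha> 2 (diagonal x) = 1 / t 2 x"
    using \<alpha>(1)[of 4 2 "diagonal x"] by (simp_all add: edge \<alpha>(2-5) s flip: diagonal_shift)
  note eqs = this
  show "C_minus_M f \<alpha> x z = stair_matrix r t m 2 x (z\<^sup>2)"
    unfolding C_minus_M_def transport_def p_matrix_def stair_matrix_def eqs
    by (rule transport_product) (simp_all add: nz nz' \<open>z > 0\<close>)
qed

text \<open>With \<open>v = 1 / cnj u\<close> the equation gives \<open>w / s = - cnj X / X\<close>
  for \<open>X = a * (u * cnj u) - cnj a\<close>, a number of modulus 1.\<close>

lemma norm_eq_of_quad:
  assumes "quad (cnj a) a s u v w" "nondeg (cnj a) a s u v w" "u * cnj v = 1"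
  shows "norm w = norm s"
proof -
  have "u \<noteq> 0" and ne: "a * u \<noteq> cnj a * v"
    using assms(2) by (auto simp: nondeg_def)
  have v: "v = 1 / cnj u"
    using assms(3) \<open>u \<noteq> 0\<close> by (metis complex_cnj_cnj complex_cnj_divide complex_cnj_one nonzero_mult_div_cancel_left)
  have "w * (a * u - cnj a * v) = s * (a * v - cnj a * u)"
    using assms(1) unfolding quad_def by algebra
  then have "w * (a * u - cnj a * v) * cnj u = s * (a * v - cnj a * u) * cnj u"
    by simp
  moreover have "(a * u - cnj a * v) * cnj u = a * (u * cnj u) - cnj a"
    "(a * v - cnj a * u) * cnj u = - cnj (a * (u * cnj u) - cnj a)"
    using \<open>u \<noteq> 0\<close> by (simp_all add: v field_simps)
  ultimately have eq: "w * (a * (u * cnj u) - cnj a) = - (s * cnj (a * (u * cnj u) - cnj a))"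
    unfolding mult_minus_right[symmetric] by (simp only: mult.assoc)
  have "(a * u - cnj a * v) * cnj u \<noteq> 0"
    using ne \<open>u \<noteq> 0\<close> by simp
  then have "a * (u * cnj u) - cnj a \<noteq> 0"
    using \<open>(a * u - cnj a * v) * cnj u = _\<close> by simp
  moreover have "norm w * norm (a * (u * cnj u) - cnj a) = norm s * norm (a * (u * cnj u) - cnj a)"
    using arg_cong[OF eq, of norm] by (simp only: norm_mult norm_minus_cancel complex_mod_cnj)
  ultimately show ?thesis by simp
qed

section \<open>From lattices to nets\<close>

lemma label_cong:
  fixes \<alpha> :: "4 \<Rightarrow> int ^ 4 \<Rightarrow> complex"
  assumes "\<And>i j x. i \<noteq> j \<Longrightarrow> \<alpha> i (x + edir j) = \<alpha> i x" "x $ i = y $ i"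
  shows "\<alpha> i x = \<alpha> i y"
proof -
  have axis_0: "z + axis j 0 = z" for z :: "int ^ 4" and j
    by (simp add: vec_eq_iff axis_def)
  have shift: "\<alpha> i (z + axis j n) = \<alpha> i z" if "j = i \<Longrightarrow> n = 0" for z j n
  proof (cases "j = i")
    case False
    show ?thesis
    proof (induction n rule: int_induct[where k = 0])
      case base
      show ?case by (simp add: axis_0)
    next
      case (step1 n)
      have "z + axis j (n + 1) = z + axis j n + edir j"
        by (simp add: vec_eq_iff axis_def)
      then show ?case using step1 assms(1) False by metis
    next
      case (step2 n)
      have "z + axis j n = z + axis j (n - 1) + edir j"
        by (simp add: vec_eq_iff axis_def)
      then show ?case using step2 assms(1) False by metis
    qed
  qed (use that in \<open>simp add: axis_0\<close>)
  have y: "y = x + axis 1 (y $ 1 - x $ 1) + axis 2 (y $ 2 - x $ 2) + axis 3 (y $ 3 - x $ 3) + axis 4 (y $ 4 - x $ 4)"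
    by (simp add: vec_eq_iff forall_4 axis_def)
  have "\<alpha> i (z + axis j (y $ j - x $ j)) = \<alpha> i z" for z j
    using assms(2) by (intro shift) auto
  then show ?thesis
    by (subst y) simp
qed

lemma C_minus_gauge_to_K_net:
  assumes "Q \<in> C_minus_representation"
  shows "\<exists>P\<in>K_net_representation. gauge_transformable Q P"
proof -
  obtain f \<alpha> where Q: "Q = (C_minus_L f \<alpha>, C_minus_M f \<alpha>)" and C: "C_minus_lattice f \<alpha>"
    and unit: "\<And>i x. norm (\<alpha> i x) = 1" and comp: "compatible (C_minus_L f \<alpha>) (C_minus_M f \<alpha>)"
    using assms unfolding C_minus_representation_def by blast
  from C have cr: "cross_ratio_system f \<alpha>"
    by (simp add: C_minus_lattice_def)
  obtain s where "s_map_of f \<alpha> s" and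
    C': "\<forall>x\<in>range diagonal. s (x + edir 1) * cnj (s (x + edir 3)) = 1 \<and>
          s (x + edir 2) * cnj (s (x + edir 4)) = 1 \<and>
          \<alpha> 1 x = cnj (\<alpha> 3 x) \<and> \<alpha> 2 x = cnj (\<alpha> 4 x)"
    using C unfolding C_minus_lattice_def by blast
  then have s0: "s 0 = 1" and edge: "\<And>i x. edge_diff f i x = \<alpha> i x * s (x + edir i) * s x"
    by (simp_all add: s_map_of_def)
  have dual: "s (diagonal x + edir 1) * cnj (s (diagonal x + edir 3)) = 1"
    "s (diagonal x + edir 2) * cnj (s (diagonal x + edir 4)) = 1"
    "\<alpha> 1 (diagonal x) = cnj (\<alpha> 3 (diagonal x))" "\<alpha> 2 (diagonal x) = cnj (\<alpha> 4 (diagonal x))" for x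
    using C' by simp_all
  note quad = cross_ratio_system_quad[OF cr edge]
  have \<alpha>_shift: "\<alpha> i (x + edir j) = \<alpha> i x" if "i \<noteq> j" for i j x
    using cr that unfolding cross_ratio_system_def by blast
  have snz: "s x \<noteq> 0" for x
    using quad(2)[of 1 2 x] by (simp add: nondeg_def)
  have cnj_unit: "cnj (\<alpha> i x) = 1 / \<alpha> i x" for i x
    using unit[of i x] by (metis complex_div_cnj complex_norm_square div_by_1 mult_1 of_real_1 power_one)

  define t where "t k x = (if k = 1 then \<alpha> 3 (diagonal x) else \<alpha> 4 (diagonal x))" for k :: 2 and x
  define r where "r x = alternate x (s (diagonal x))" for x
  define l where "l x = alternate x (1 / s (diagonal x + edir 1))" for x
  define m where "m x = alternate x (1 / s (diagonal x + edir 2))" for x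
  have s: "s (diagonal x) = alternate x (r x)" "s (diagonal x + edir 1) = alternate x (1 / l x)"
    "s (diagonal x + edir 2) = alternate x (1 / m x)" for x
    by (simp_all add: r_def l_def m_def)
  have t: "\<alpha> 1 (diagonal x) = 1 / t 1 x" "\<alpha> 3 (diagonal x) = t 1 x"
    "\<alpha> 2 (diagonal x) = 1 / t 2 x" "\<alpha> 4 (diagonal x) = t 2 x" for x
    by (simp_all add: t_def dual cnj_unit)
  have t_unit: "norm (t k x) = 1" for k x
    by (simp add: t_def unit)
  \<comment> \<open>The normalization \<open>s 0 = 1\<close> anchors the modulus, and the duality
    preserves it along each step of the diagonal net.\<close>
  have "norm (s (diagonal x)) = 1" for x
  proof (induction x rule: int_vec_2_induct)
    case 1
    have "diagonal 0 = 0"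
      by (simp add: diagonal_def vec_eq_iff forall_4)
    then show ?case by (simp add: s0)
  next
    case (2 x k)
    have "norm (s (diagonal (x + edir k))) = norm (s (diagonal x))"
    proof (cases "k = 1")
      case True
      show ?thesis
        unfolding True diagonal_shift
        using quad[of 1 3 "diagonal x"] dual(1,3) by (intro norm_eq_of_quad) auto
    next
      case False
      then have k: "k = 2" using exhaust_2 by auto
      show ?thesis
        unfolding k diagonal_shift
        using quad[of 2 4 "diagonal x"] dual(2,4) by (intro norm_eq_of_quad) auto
    qed
    then show ?case by simp
  qed
  then have r_unit: "norm (r x) = 1" for x
    by (simp add: r_def alternate_def norm_divide)
  have nz: "r x \<noteq> 0" "t k x \<noteq> 0" "l x \<noteq> 0" "m x \<noteq> 0" for k x
    using r_unit[of x] t_unit[of k x] snz by (auto simp: l_def m_def alternate_def)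
  have gauge: "gauge_transformable Q (K_net_matrix r t l 1, K_net_matrix r t m 2)"
    unfolding Q by (rule gauge_transformable_C_minus_K_net[OF edge \<alpha>_shift t s nz])

  have "labelling t"
    unfolding labelling_def
  proof (intro allI impI)
    fix i x y
    assume "x $ i = (y :: int ^ 2) $ i"
    then show "t i x = t i y"
      unfolding t_def using exhaust_2[of i]
      by (auto intro!: label_cong[where \<alpha> = \<alpha>, OF \<alpha>_shift] simp: diagonal_def)
  qed
  moreover have "quaternionic (K_net_matrix r t l 1 x z)" "quaternionic (K_net_matrix r t m 2 x z)" if "z > 0" for x z
  proof -
    have *: "a * s + w / a = u * cnj u * (s / a + a * w)"
      if "quad (1 / a) a s u v w" "u * cnj v = 1" for a s u v w
    proof -
      have "cnj (u * cnj v) = 1"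
        unfolding that(2) by simp
      then have v: "cnj u * v = 1"
        by simp
      have "u * (a * w + s * (1 / a)) = v * (w * (1 / a) + a * s)"
        using that(1) unfolding quad_def by algebra
      then have "u * cnj u * (s * (1 / a) + a * w) = a * s + w * (1 / a)"
        using v by algebra
      then show ?thesis by simp
    qed
    show "quaternionic (K_net_matrix r t l 1 x z)"
      using *[OF quad(1)[of 1 3 "diagonal x", simplified t] dual(1)[of x]]
      by (subst quaternionic_K_net_iff[OF r_unit r_unit t_unit nz(3) that refl refl refl])
        (simp flip: s diagonal_shift)
    show "quaternionic (K_net_matrix r t m 2 x z)"
      using *[OF quad(1)[of 2 4 "diagonal x", simplified t] dual(2)[of x]]
      by (subst quaternionic_K_net_iff[OF r_unit r_unit t_unit nz(4) that refl refl refl])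
        (simp flip: s diagonal_shift)
  qed
  moreover have "nondegenerate r t l m"
  proof -
    have label: "induced_label t i x = \<alpha> i x" for i x
    proof -
      have "induced_label t i x = \<alpha> i (diagonal (vector [x $ 1, x $ 2]))" if "i = 1 \<or> i = 2"
        using that by (auto simp: induced_label_def t)
      moreover have "induced_label t i x = \<alpha> i (diagonal (vector [x $ 3, x $ 4]))" if "i = 3 \<or> i = 4"
        using that by (auto simp: induced_label_def t)
      moreover have "\<alpha> i (diagonal (vector [x $ 1, x $ 2])) = \<alpha> i x" if "i = 1 \<or> i = 2"
        using that by (intro label_cong[where \<alpha> = \<alpha>, OF \<alpha>_shift]) (auto simp: diagonal_def)
      moreover have "\<alpha> i (diagonal (vector [x $ 3, x $ 4])) = \<alpha> i x" if "i = 3 \<or> i = 4"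
        using that by (intro label_cong[where \<alpha> = \<alpha>, OF \<alpha>_shift]) (auto simp: diagonal_def)
      ultimately show ?thesis
        using exhaust_4[of i] by metis
    qed
    \<comment> \<open>Each rule of \<open>propagated\<close> solves a quad equation that
      \<open>s\<close> satisfies with nonzero denominator, so whatever the order of solving, it
      returns the value of \<open>s\<close>.\<close>
    have "v = s x" if "propagated r t l m x v" for x v
      using that
    proof induction
      case (forward i j x s0 si sj ai aj)
      then have "s0 = s x" "si = s (x + edir i)" "sj = s (x + edir j)" "ai = \<alpha> i x" "aj = \<alpha> j x"
        by (simp_all add: label)
      then show ?case
        using quad[OF forward(1), of x] unfolding quad_def nondeg_def
        by (simp add: divide_eq_eq algebra_simps)
    next
      case (sideways i j x s0 si sij ai aj)
      then have "s0 = s x" "si = s (x + edir i)" "sij = s (x + edir i + edir j)" "ai = \<alpha> i x" "aj = \<alpha> j x"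
        by (simp_all add: label)
      then show ?case
        using quad[OF sideways(1), of x] unfolding quad_def nondeg_def
        by (simp add: divide_eq_eq algebra_simps)
    next
      case (backward i j x si sj sij ai aj)
      then have "sj = s (x + edir j)" "si = s (x + edir i)" "sij = s (x + edir i + edir j)" "ai = \<alpha> i x" "aj = \<alpha> j x"
        by (simp_all add: label)
      then show ?case
        using quad[OF backward(1), of x] unfolding quad_def nondeg_def
        by (simp add: divide_eq_eq algebra_simps)
    qed (simp_all add: s)
    then show ?thesis
      using snz unfolding nondegenerate_def by metis
  qed
  moreover have "compatible (K_net_matrix r t l 1) (K_net_matrix r t m 2)"
    using gauge_transformable_compatible comp gauge unfolding Q by blast
  ultimately have "(K_net_matrix r t l 1, K_net_matrix r t m 2) \<in> K_net_representation"
    unfolding K_net_representation_def using r_unit t_unit nz by blast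
  then show ?thesis
    using gauge by blast
qed

section \<open>From nets to lattices\<close>

definition antidiff :: "(int \<Rightarrow> complex) \<Rightarrow> int \<Rightarrow> complex" where
  "antidiff g n = (if n \<ge> 0 then sum g {0..<n} else - sum g {n..<0})"

lemma antidiff_Suc: "antidiff g (n + 1) = antidiff g n + g n"
proof (cases "n \<ge> 0")
  case True
  then have "{0..<n + 1} = insert n {0..<n}" by auto
  then show ?thesis using True by (simp add: antidiff_def)
next
  case False
  then have "{n..<0} = insert n {n + 1..<0}" by auto
  then show ?thesis using False by (simp add: antidiff_def)
qed

lemma antidiff_0 [simp]: "antidiff g 0 = 0"
  by (simp add: antidiff_def)

text \<open>Closing a strip of quads: \<open>g\<close> and \<open>h\<close> run along its two long
  sides, and \<open>k\<close> gives the rungs.\<close>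

lemma antidiff_diff:
  assumes "\<And>n. h n + k (n + 1) = k n + g n"
  shows "antidiff g n + k 0 = k n + antidiff h n"
proof (induction n rule: int_induct[where k = 0])
  case base
  show ?case by simp
next
  case (step1 n)
  then show ?case
    using assms[of n] by (simp add: antidiff_Suc) algebra
next
  case (step2 n)
  then show ?case
    using assms[of "n - 1"] antidiff_Suc[of g "n - 1"] antidiff_Suc[of h "n - 1"] by simp algebra
qed

text \<open>A discrete Poincare lemma. \<open>F\<close> sums along the path from 0 that follows the
  axes in the order 1, 3, 2, 4. Changing one coordinate displaces all later segments sideways, and
  each identity of \<open>d\<close> pushes the increment across one such segment.\<close>

lemma potential_exists:
  fixes e :: "4 \<Rightarrow> int ^ 4 \<Rightarrow> complex"
  assumes "\<And>i j x. i \<noteq> j \<Longrightarrow> e i x + e j (x + edir i) = e j x + e i (x + edir j)"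
  shows "\<exists>f. \<forall>i x. edge_diff f i x = e i x"
proof -
  define F where "F a b c d = antidiff (\<lambda>n. e 1 (pt n 0 0 0)) a + antidiff (\<lambda>n. e 3 (pt a n 0 0)) b +
    antidiff (\<lambda>n. e 2 (pt a b n 0)) c + antidiff (\<lambda>n. e 4 (pt a b c n)) d" for a b c d
  define f where "f x = F (x $ 1) (x $ 3) (x $ 2) (x $ 4)" for x :: "int ^ 4"
  have c: "e 1 (pt a b c d) + e 3 (pt (a + 1) b c d) = e 3 (pt a b c d) + e 1 (pt a (b + 1) c d)"
    "e 1 (pt a b c d) + e 2 (pt (a + 1) b c d) = e 2 (pt a b c d) + e 1 (pt a b (c + 1) d)"
    "e 1 (pt a b c d) + e 4 (pt (a + 1) b c d) = e 4 (pt a b c d) + e 1 (pt a b c (d + 1))"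
    "e 3 (pt a b c d) + e 2 (pt a (b + 1) c d) = e 2 (pt a b c d) + e 3 (pt a b (c + 1) d)"
    "e 3 (pt a b c d) + e 4 (pt a (b + 1) c d) = e 4 (pt a b c d) + e 3 (pt a b c (d + 1))"
    "e 2 (pt a b c d) + e 4 (pt a b (c + 1) d) = e 4 (pt a b c d) + e 2 (pt a b c (d + 1))" for a b c d
    using assms[of 1 3 "pt a b c d"] assms[of 1 2 "pt a b c d"] assms[of 1 4 "pt a b c d"]
      assms[of 3 2 "pt a b c d"] assms[of 3 4 "pt a b c d"] assms[of 2 4 "pt a b c d"] by simp_all
  have d: "antidiff (\<lambda>n. e 3 (pt (a + 1) n 0 0)) b + e 1 (pt a 0 0 0) = e 1 (pt a b 0 0) + antidiff (\<lambda>n. e 3 (pt a n 0 0)) b"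
    "antidiff (\<lambda>n. e 2 (pt (a + 1) b n 0)) c + e 1 (pt a b 0 0) = e 1 (pt a b c 0) + antidiff (\<lambda>n. e 2 (pt a b n 0)) c"
    "antidiff (\<lambda>n. e 4 (pt (a + 1) b c n)) d + e 1 (pt a b c 0) = e 1 (pt a b c d) + antidiff (\<lambda>n. e 4 (pt a b c n)) d"
    "antidiff (\<lambda>n. e 2 (pt a (b + 1) n 0)) c + e 3 (pt a b 0 0) = e 3 (pt a b c 0) + antidiff (\<lambda>n. e 2 (pt a b n 0)) c"
    "antidiff (\<lambda>n. e 4 (pt a (b + 1) c n)) d + e 3 (pt a b c 0) = e 3 (pt a b c d) + antidiff (\<lambda>n. e 4 (pt a b c n)) d"
    "antidiff (\<lambda>n. e 4 (pt a b (c + 1) n)) d + e 2 (pt a b c 0) = e 2 (pt a b c d) + antidiff (\<lambda>n. e 4 (pt a b c n)) d"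
    for a b c d
    by (rule antidiff_diff, metis c add.commute)+
  have F: "F (a + 1) b c d - F a b c d = e 1 (pt a b c d)" "F a (b + 1) c d - F a b c d = e 3 (pt a b c d)"
    "F a b (c + 1) d - F a b c d = e 2 (pt a b c d)" "F a b c (d + 1) - F a b c d = e 4 (pt a b c d)" for a b c d
    using d(1)[of a b] d(2)[of a b c] d(3)[of a b c d] d(4)[of a b c] d(5)[of a b c d] d(6)[of a b c d]
    unfolding F_def antidiff_Suc by (algebra | simp)+
  have "edge_diff f i x = e i x" for i x
  proof (cases x rule: pt_cases)
    case (1 a b c d)
    show ?thesis
      using exhaust_4[of i] F[of a b c d] unfolding 1 edge_diff_def by (auto simp: f_def axis_def)
  qed
  then show ?thesis by blast
qed

text \<open>The quad equations say that the prescribed edges form a closed edge function. In the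
  cross-ratios the values of \<open>s\<close> cancel; \<open>nondeg\<close> keeps the sides and the
  diagonals of each quad from vanishing.\<close>

lemma cross_ratio_system_of_quads:
  assumes label: "\<And>i j x. i \<noteq> j \<Longrightarrow> \<alpha> i (x + edir j) = \<alpha> i x" "\<And>i x. \<alpha> i x \<noteq> 0"
    and quad: "\<And>i j x. i \<noteq> j \<Longrightarrow> quad (\<alpha> i x) (\<alpha> j x) (s x) (s (x + edir i)) (s (x + edir j)) (s (x + edir i + edir j))"
    and nondeg: "\<And>i j x. i \<noteq> j \<Longrightarrow> nondeg (\<alpha> i x) (\<alpha> j x) (s x) (s (x + edir i)) (s (x + edir j)) (s (x + edir i + edir j))"
  shows "\<exists>f. cross_ratio_system f \<alpha> \<and> (\<forall>i x. edge_diff f i x = \<alpha> i x * s (x + edir i) * s x)"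
proof -
  have comm: "x + edir j + edir i = x + edir i + edir j" for i j :: 4 and x :: "int ^ 4"
    by (simp add: algebra_simps)
  have "\<alpha> i x * s (x + edir i) * s x + \<alpha> j (x + edir i) * s (x + edir i + edir j) * s (x + edir i) =
      \<alpha> j x * s (x + edir j) * s x + \<alpha> i (x + edir j) * s (x + edir j + edir i) * s (x + edir j)"
    if "i \<noteq> j" for i j x
    using quad[OF that, of x] label(1)[OF that, of x] label(1)[OF that[symmetric], of x]
    unfolding quad_def comm[of x j i] by algebra
  then obtain f where edge: "\<And>i x. edge_diff f i x = \<alpha> i x * s (x + edir i) * s x"
    using potential_exists[of "\<lambda>i x. \<alpha> i x * s (x + edir i) * s x"] by blast
  have "cross_ratio_system f \<alpha>"
    unfolding cross_ratio_system_def
  proof (intro conjI allI impI)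
    fix i j :: 4 and x
    assume "i \<noteq> j"
    let ?a = "\<alpha> i x" and ?b = "\<alpha> j x"
    let ?s = "s x" and ?si = "s (x + edir i)" and ?sj = "s (x + edir j)" and ?sij = "s (x + edir i + edir j)"
    have l: "\<alpha> i (x + edir j) = ?a" "\<alpha> j (x + edir i) = ?b"
      using label(1) \<open>i \<noteq> j\<close> by metis+
    then show "\<alpha> i (x + edir j) = \<alpha> i x" by simp
    have e: "edge_diff f i x = ?a * ?si * ?s" "edge_diff f j x = ?b * ?sj * ?s"
      "edge_diff f i (x + edir j) = ?a * ?sij * ?sj" "edge_diff f j (x + edir i) = ?b * ?sij * ?si"
      by (simp_all add: edge l comm[of x j i])
    then have f: "f (x + edir i) - f x = ?a * ?si * ?s" "f (x + edir j) - f x = ?b * ?sj * ?s"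
      "f (x + edir i + edir j) - f (x + edir j) = ?a * ?sij * ?sj"
      "f (x + edir i + edir j) - f (x + edir i) = ?b * ?sij * ?si"
      by (simp_all add: edge_diff_def comm[of x j i])
    have nd: "?s \<noteq> 0" "?si \<noteq> 0" "?sj \<noteq> 0" "?sij \<noteq> 0" "?b * ?sj - ?a * ?si \<noteq> 0" "?a * ?s + ?b * ?sij \<noteq> 0"
      "?a \<noteq> 0" "?b \<noteq> 0"
      using nondeg[OF \<open>i \<noteq> j\<close>, of x] label(2) by (simp_all add: nondeg_def)
    show "edge_diff f i x * edge_diff f i (x + edir j) / (edge_diff f j x * edge_diff f j (x + edir i)) =
        ?a\<^sup>2 / ?b\<^sup>2"
      unfolding e using nd by (simp add: power2_eq_square)
    have "f (x + edir i + edir j) - f x = ?si * (?a * ?s + ?b * ?sij)"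
      "f (x + edir j) - f (x + edir i) = ?s * (?b * ?sj - ?a * ?si)"
      using f by algebra+
    then have "f (x + edir i + edir j) - f x \<noteq> 0" "f (x + edir j) - f (x + edir i) \<noteq> 0"
      using nd by simp_all
    moreover have "f (x + edir i) - f x \<noteq> 0" "f (x + edir j) - f x \<noteq> 0"
      "f (x + edir i + edir j) - f (x + edir j) \<noteq> 0" "f (x + edir i + edir j) - f (x + edir i) \<noteq> 0"
      unfolding f using nd by simp_all
    ultimately show "distinct [f x, f (x + edir i), f (x + edir i + edir j), f (x + edir j)]"
      by auto
  qed (rule label(2))
  then show ?thesis using edge by blast
qed

lemma vector_2_edir [simp]:
  "(vector [a, c] :: int ^ 2) + edir 1 = vector [a + 1, c]"
  "(vector [a, c] :: int ^ 2) + edir 2 = vector [a, c + 1]"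
  by (simp_all add: vec_eq_iff forall_2 axis_def)

lemma vector_2_eta: "vector [x $ 1, x $ 2] = (x :: int ^ 2)"
  by (simp add: vec_eq_iff forall_2)

lemma diagonal_vector: "diagonal (vector [a, c]) = pt a a c c"
  by (simp add: diagonal_pt)

section \<open>The map s on the whole grid, constructed from a nondegenerate net\<close>

context
  fixes r :: "int ^ 2 \<Rightarrow> complex" and t :: "2 \<Rightarrow> int ^ 2 \<Rightarrow> complex" and l m :: "int ^ 2 \<Rightarrow> complex"
  assumes nondegenerate: "nondegenerate r t l m"
    and labelling: "labelling t"
    and nonzero: "\<And>x. r x \<noteq> 0" "\<And>i x. t i x \<noteq> 0" "\<And>x. l x \<noteq> 0" "\<And>x. m x \<noteq> 0"
    and compatible: "compatible (K_net_matrix r t l 1) (K_net_matrix r t m 2)"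
begin

abbreviation reached :: "int ^ 4 \<Rightarrow> complex \<Rightarrow> bool" where
  "reached \<equiv> propagated r t l m"

definition label1 where "label1 a = 1 / t 1 (vector [a, 0])"
definition label3 where "label3 b = t 1 (vector [b, 0])"
definition label2 where "label2 c = 1 / t 2 (vector [0, c])"
definition label4 where "label4 d = t 2 (vector [0, d])"

lemma induced_label_pt [simp]:
  "induced_label t 1 (pt a b c d) = label1 a" "induced_label t 3 (pt a b c d) = label3 b"
  "induced_label t 2 (pt a b c d) = label2 c" "induced_label t 4 (pt a b c d) = label4 d"
proof -
  have "t 1 (vector [a, c]) = t 1 (vector [a, 0])" "t 2 (vector [a, c]) = t 2 (vector [0, c])" for a c
    using labelling unfolding labelling_def by (metis vector_2)+
  then show "induced_label t 1 (pt a b c d) = label1 a" "induced_label t 3 (pt a b c d) = label3 b"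
    "induced_label t 2 (pt a b c d) = label2 c" "induced_label t 4 (pt a b c d) = label4 d"
    by (simp_all add: induced_label_def label1_def label3_def label2_def label4_def)
qed

lemma label_vector: "t 1 (vector [a, c]) = label3 a" "t 2 (vector [a, c]) = label4 c"
  "label1 a = 1 / label3 a" "label2 c = 1 / label4 c" "label3 a \<noteq> 0" "label4 c \<noteq> 0"
proof -
  show "t 1 (vector [a, c]) = label3 a" "t 2 (vector [a, c]) = label4 c"
    using labelling unfolding labelling_def label3_def label4_def by (metis vector_2)+
qed (simp_all add: label1_def label3_def label2_def label4_def nonzero)

lemma reached_nonzero: "reached x v \<Longrightarrow> v \<noteq> 0"
  using nondegenerate unfolding nondegenerate_def by metis

lemma reached_sideways:
  assumes "i \<noteq> j" "reached x s" "reached (x + edir i) s\<^sub>i" "reached (x + edir i + edir j) s\<^sub>i\<^sub>j"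
  shows "reached (x + edir j) (sideways (induced_label t i x) (induced_label t j x) s s\<^sub>i s\<^sub>i\<^sub>j)"
  unfolding sideways_def by (rule propagated.sideways[OF assms refl refl])

text \<open>The quotient is itself a propagated value, hence nonzero; by \<open>z / 0 = 0\<close>
  neither its numerator nor its denominator vanishes.\<close>

lemma reached_sideways_nonzero:
  assumes "i \<noteq> j" "reached x s" "reached (x + edir i) s\<^sub>i" "reached (x + edir i + edir j) s\<^sub>i\<^sub>j"
  shows "induced_label t i x * s + induced_label t j x * s\<^sub>i\<^sub>j \<noteq> 0"
    "induced_label t j x * s + induced_label t i x * s\<^sub>i\<^sub>j \<noteq> 0"
  using reached_nonzero[OF reached_sideways[OF assms]] by (auto simp: sideways_def)

lemma reached_forward_nonzero:
  assumes "i \<noteq> j" "reached x s" "reached (x + edir i) s\<^sub>i" "reached (x + edir j) s\<^sub>j"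
  shows "induced_label t j x * s\<^sub>j \<noteq> induced_label t i x * s\<^sub>i"
    "induced_label t j x * s\<^sub>i \<noteq> induced_label t i x * s\<^sub>j"
  using reached_nonzero[OF propagated.forward[OF assms refl refl]] by auto

lemma reached_nondeg:
  assumes "i \<noteq> j" "reached x s" "reached (x + edir i) s\<^sub>i" "reached (x + edir j) s\<^sub>j" "reached (x + edir i + edir j) s\<^sub>i\<^sub>j"
  shows "nondeg (induced_label t i x) (induced_label t j x) s s\<^sub>i s\<^sub>j s\<^sub>i\<^sub>j"
  unfolding nondeg_def
  using reached_forward_nonzero[OF assms(1-4)] reached_sideways_nonzero[OF assms(1-3,5)] assms(2-5)[THEN reached_nonzero]
  by simp

text \<open>The pairs of directions come in the order 13, 24, 12, 14, 32, 34, to which later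
  selections by number refer.\<close>

lemmas reached_nondeg_pt =
  reached_nondeg[of 1 3 "pt a b c d" for a b c d, simplified] reached_nondeg[of 2 4 "pt a b c d" for a b c d, simplified]
  reached_nondeg[of 1 2 "pt a b c d" for a b c d, simplified] reached_nondeg[of 1 4 "pt a b c d" for a b c d, simplified]
  reached_nondeg[of 3 2 "pt a b c d" for a b c d, simplified] reached_nondeg[of 3 4 "pt a b c d" for a b c d, simplified]

lemmas reached_sideways_nonzero_pt =
  reached_sideways_nonzero(1)[of 1 3 "pt a b c d" for a b c d, simplified]
  reached_sideways_nonzero(1)[of 2 4 "pt a b c d" for a b c d, simplified]

lemmas reached_sideways_pt =
  reached_sideways[of 1 3 "pt a b c d" for a b c d, simplified] reached_sideways[of 3 1 "pt a b c d" for a b c d, simplified]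
  reached_sideways[of 2 4 "pt a b c d" for a b c d, simplified] reached_sideways[of 4 2 "pt a b c d" for a b c d, simplified]

text \<open>The two digits are the offsets \<open>x\<^sub>1 - x\<^sub>3\<close> and
  \<open>x\<^sub>2 - x\<^sub>4\<close> from the diagonal net. With both offsets 1 there is no datum
  of the net, so \<open>init11\<close> is solved from the quad in the directions 1, 2.\<close>

definition init00 where "init00 a c = alternate (vector [a, c]) (r (vector [a, c]))"
definition init10 where "init10 a c = alternate (vector [a, c]) (1 / l (vector [a, c]))"
definition init01 where "init01 a c = alternate (vector [a, c]) (1 / m (vector [a, c]))"
definition init11 where
  "init11 a c = init00 a c * (label2 c * init01 a c - label1 a * init10 a c) / (label2 c * init10 a c - label1 a * init01 a c)"

lemma reached_surface:
  "reached (pt a a c c) (init00 a c)" "reached (pt (a + 1) a c c) (init10 a c)"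
  "reached (pt a a (c + 1) c) (init01 a c)" "reached (pt (a + 1) a (c + 1) c) (init11 a c)"
proof -
  show *: "reached (pt a a c c) (init00 a c)" "reached (pt (a + 1) a c c) (init10 a c)" "reached (pt a a (c + 1) c) (init01 a c)"
    using propagated.vertex[of r t l m "vector [a, c]"] propagated.edge1[of r t l m "vector [a, c]"]
      propagated.edge2[of r t l m "vector [a, c]"]
    by (simp_all add: diagonal_vector init00_def init10_def init01_def)
  show "reached (pt (a + 1) a (c + 1) c) (init11 a c)"
    using propagated.forward[of 1 2 r t l m "pt a a c c" "init00 a c" "init10 a c" "init01 a c" "label1 a" "label2 c"] *
    by (simp add: init11_def)
qed

lemmas surface_nonzero = reached_surface[THEN reached_nonzero]

lemma stair_matrices_compatible: "compatible (stair_matrix r t l 1) (stair_matrix r t m 2)"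
proof -
  have "gauge_transformable (stair_matrix r t l 1, stair_matrix r t m 2)
      (K_net_matrix r t l 1, K_net_matrix r t m 2)"
    by (rule gauge_transformable_K_net[OF nonzero homeomorphism_ident]) simp_all
  then show ?thesis
    using gauge_transformable_compatible gauge_transformable_sym compatible by blast
qed

text \<open>The 2 by 2 block over one cell of the diagonal net: the first equation holds by the
  choice of \<open>init11\<close>, the others by compatibility at that cell.\<close>

lemma surface_quads:
  "quad (label1 n) (label2 c) (init00 n c) (init10 n c) (init01 n c) (init11 n c)"
  "quad (label1 n) (label4 c) (init01 n c) (init11 n c) (init00 n (c + 1)) (init10 n (c + 1))"
  "quad (label2 c) (label3 n) (init10 n c) (init11 n c) (init00 (n + 1) c) (init01 (n + 1) c)"
  "quad (label3 n) (label4 c) (init11 n c) (init01 (n + 1) c) (init10 n (c + 1)) (init00 (n + 1) (c + 1))"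
proof -
  have "label2 c * init10 n c \<noteq> label1 n * init01 n c"
    using reached_forward_nonzero(2)[of 1 2 "pt n n c c"] reached_surface[of n c] by simp
  then have "init11 n c * (label2 c * init10 n c - label1 n * init01 n c) = init00 n c * (label2 c * init01 n c - label1 n * init10 n c)"
    by (simp add: init11_def)
  then show q: "quad (label1 n) (label2 c) (init00 n c) (init10 n c) (init01 n c) (init11 n c)"
    unfolding quad_def by algebra
  have "lax_step (label4 c) (init00 (n + 1) c) (init01 (n + 1) c) (init00 (n + 1) (c + 1)) z **
      lax_step (label3 n) (init00 n c) (init10 n c) (init00 (n + 1) c) z =
      lax_step (label3 n) (init00 n (c + 1)) (init10 n (c + 1)) (init00 (n + 1) (c + 1)) z **
      lax_step (label4 c) (init00 n c) (init01 n c) (init00 n (c + 1)) z" if "z > 0" for z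
    using stair_matrices_compatible that unfolding compatible_def stair_matrix_def
    by (auto simp: init00_def init10_def init01_def label_vector dest!: spec[of _ "vector [n, c]"])
  note quads = lax_step_commute_quads[OF this surface_nonzero(1) surface_nonzero(1) surface_nonzero(1)
      surface_nonzero(1) surface_nonzero(2) surface_nonzero(3) label_vector(5,6)]
  \<comment> \<open>A diagonal of a quad in the directions 1, 3. This quad is not part of the
    surface, but three of its vertices are, and solving for the fourth must not degenerate.\<close>
  have "label3 n * init00 (n + 1) (c + 1) + init00 n (c + 1) / label3 n \<noteq> 0"
    using reached_sideways_nonzero_pt(1)[OF reached_surface(1)[of n "c + 1"] reached_surface(2) reached_surface(1)]
    by (simp add: label_vector(3) add.commute)
  moreover have "label4 c * init00 (n + 1) (c + 1) + init00 (n + 1) c / label4 c \<noteq> 0"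
    using reached_sideways_nonzero_pt(2)[OF reached_surface(1)[of "n + 1" c] reached_surface(3) reached_surface(1)]
    by (simp add: label_vector(4) add.commute)
  moreover have "nondeg (label1 n) (label2 c) (init00 n c) (init10 n c) (init01 n c) (init11 n c)"
    using reached_nondeg_pt(3) reached_surface by blast
  ultimately show "quad (label1 n) (label4 c) (init01 n c) (init11 n c) (init00 n (c + 1)) (init10 n (c + 1))"
    "quad (label2 c) (label3 n) (init10 n c) (init11 n c) (init00 (n + 1) c) (init01 (n + 1) c)"
    "quad (label3 n) (label4 c) (init11 n c) (init01 (n + 1) c) (init10 n (c + 1)) (init00 (n + 1) (c + 1))"
    using quads q unfolding label_vector(3,4) by blast+
qed

text \<open>The planes \<open>level0 c\<close> and \<open>level1 c\<close> lie over the points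
  \<open>(c, c)\<close> and \<open>(c + 1, c)\<close> of a staircase in the directions 2, 4. From it
  \<open>solution\<close> is extended for each \<open>(a, b)\<close> separately, so that off these
  planes only the quads in the directions 2, 4 hold by construction.\<close>

definition level0 where "level0 c = stair_ext label1 label3 (\<lambda>n. init00 n c) (\<lambda>n. init10 n c)"
definition level1 where "level1 c = stair_ext label1 label3 (\<lambda>n. init01 n c) (\<lambda>n. init11 n c)"
definition solution where "solution a b = stair_ext label2 label4 (\<lambda>n. level0 n a b) (\<lambda>n. level1 n a b)"

lemma reached_level: "reached (pt a b c c) (level0 c a b)" "reached (pt a b (c + 1) c) (level1 c a b)"
  unfolding level0_def level1_def
  by (rule stair_ext_in[where P = "\<lambda>a b. reached (pt a b c c)"] stair_ext_in[where P = "\<lambda>a b. reached (pt a b (c + 1) c)"];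
      (rule reached_surface | rule reached_sideways_pt; assumption))+

lemma reached_solution: "reached (pt a b c d) (solution a b c d)"
  unfolding solution_def
  by (rule stair_ext_in[where P = "\<lambda>c d. reached (pt a b c d)"]; (rule reached_level | rule reached_sideways_pt; assumption))

lemma level_quads:
  "quad (label1 a) (label3 b) (level0 c a b) (level0 c (a + 1) b) (level0 c a (b + 1)) (level0 c (a + 1) (b + 1))"
  "quad (label1 a) (label3 b) (level1 c a b) (level1 c (a + 1) b) (level1 c a (b + 1)) (level1 c (a + 1) (b + 1))"
  using reached_level[THEN reached_nonzero] stair_ext_quad unfolding level0_def level1_def by simp_all

lemma solution_quads_24: "quad (label2 c) (label4 d) (solution a b c d) (solution a b (c + 1) d) (solution a b c (d + 1)) (solution a b (c + 1) (d + 1))"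
  using reached_solution[THEN reached_nonzero] stair_ext_quad unfolding solution_def by simp

lemma level_stair [simp]:
  "level0 c n n = init00 n c" "level0 c (n + 1) n = init10 n c" "level1 c n n = init01 n c" "level1 c (n + 1) n = init11 n c"
  by (simp_all add: level0_def level1_def)

lemma solution_stair [simp]: "solution a b n n = level0 n a b" "solution a b (n + 1) n = level1 n a b"
  by (simp_all add: solution_def)

lemmas level_nondeg =
  reached_nondeg_pt(1)[OF reached_level(1) reached_level(1) reached_level(1) reached_level(1)] reached_nondeg_pt(1)[OF reached_level(2) reached_level(2) reached_level(2) reached_level(2)]
  reached_nondeg_pt(3)[OF reached_level(1) reached_level(1) reached_level(2) reached_level(2)] reached_nondeg_pt(5)[OF reached_level(1) reached_level(1) reached_level(2) reached_level(2)]
  reached_nondeg_pt(4)[OF reached_level(2) reached_level(2) reached_level(1) reached_level(1)] reached_nondeg_pt(6)[OF reached_level(2) reached_level(2) reached_level(1) reached_level(1)]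

text \<open>Neighbouring planes are one step apart, in direction 2 or in direction 4. Over the
  staircase the equations are those of the surface.\<close>

lemma level_vertical:
  "quad (label1 a) (label2 c) (level0 c a b) (level0 c (a + 1) b) (level1 c a b) (level1 c (a + 1) b) \<and>
   quad (label3 b) (label2 c) (level0 c a b) (level0 c a (b + 1)) (level1 c a b) (level1 c a (b + 1))"
  "quad (label1 a) (label4 c) (level1 c a b) (level1 c (a + 1) b) (level0 (c + 1) a b) (level0 (c + 1) (a + 1) b) \<and>
   quad (label3 b) (label4 c) (level1 c a b) (level1 c a (b + 1)) (level0 (c + 1) a b) (level0 (c + 1) a (b + 1))"
proof -
  show "quad (label1 a) (label2 c) (level0 c a b) (level0 c (a + 1) b) (level1 c a b) (level1 c (a + 1) b) \<and>
     quad (label3 b) (label2 c) (level0 c a b) (level0 c a (b + 1)) (level1 c a b) (level1 c a (b + 1))"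
    by (rule vertical_quads[of label1 label3 "level0 c" "level1 c" "label2 c", OF level_quads level_nondeg(1,3,4)])
      (simp_all add: surface_quads(1) surface_quads(3)[THEN quad_swap[THEN iffD1]])
  show "quad (label1 a) (label4 c) (level1 c a b) (level1 c (a + 1) b) (level0 (c + 1) a b) (level0 (c + 1) (a + 1) b) \<and>
     quad (label3 b) (label4 c) (level1 c a b) (level1 c a (b + 1)) (level0 (c + 1) a b) (level0 (c + 1) a (b + 1))"
    by (rule vertical_quads[of label1 label3 "level1 c" "level0 (c + 1)" "label4 c", OF level_quads(2,1) level_nondeg(2,5,6)])
      (simp_all add: surface_quads(2,4))
qed

lemmas solution_nondeg = reached_nondeg_pt[OF reached_solution reached_solution reached_solution reached_solution]

text \<open>The pairs of directions exchange their roles: planes in the directions 2, 4 are stacked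
  along 1 or 3, and \<open>level_vertical\<close> supplies the equations over their
  staircases.\<close>

lemma solution_vertical:
  "quad (label2 c) (label1 a) (solution a b c d) (solution a b (c + 1) d) (solution (a + 1) b c d) (solution (a + 1) b (c + 1) d) \<and>
   quad (label4 d) (label1 a) (solution a b c d) (solution a b c (d + 1)) (solution (a + 1) b c d) (solution (a + 1) b c (d + 1))"
  "quad (label2 c) (label3 b) (solution a b c d) (solution a b (c + 1) d) (solution a (b + 1) c d) (solution a (b + 1) (c + 1) d) \<and>
   quad (label4 d) (label3 b) (solution a b c d) (solution a b c (d + 1)) (solution a (b + 1) c d) (solution a (b + 1) c (d + 1))"
proof -
  have U: "quad (label2 c) (label1 a) (level0 c a b) (level1 c a b) (level0 c (a + 1) b) (level1 c (a + 1) b)"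
    "quad (label2 c) (label3 b) (level0 c a b) (level1 c a b) (level0 c a (b + 1)) (level1 c a (b + 1))"
    "quad (label4 c) (label1 a) (level1 c a b) (level0 (c + 1) a b) (level1 c (a + 1) b) (level0 (c + 1) (a + 1) b)"
    "quad (label4 c) (label3 b) (level1 c a b) (level0 (c + 1) a b) (level1 c a (b + 1)) (level0 (c + 1) a (b + 1))" for a b c
    using level_vertical quad_swap by blast+
  note nondeg = solution_nondeg[THEN nondeg_swap[THEN iffD1]]
  show "quad (label2 c) (label1 a) (solution a b c d) (solution a b (c + 1) d) (solution (a + 1) b c d) (solution (a + 1) b (c + 1) d) \<and>
     quad (label4 d) (label1 a) (solution a b c d) (solution a b c (d + 1)) (solution (a + 1) b c d) (solution (a + 1) b c (d + 1))"
    by (rule vertical_quads[of label2 label4 "solution a b" "solution (a + 1) b" "label1 a",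
        OF solution_quads_24 solution_quads_24 solution_nondeg(2) nondeg(3,4)]) (simp_all add: U)
  show "quad (label2 c) (label3 b) (solution a b c d) (solution a b (c + 1) d) (solution a (b + 1) c d) (solution a (b + 1) (c + 1) d) \<and>
     quad (label4 d) (label3 b) (solution a b c d) (solution a b c (d + 1)) (solution a (b + 1) c d) (solution a (b + 1) c (d + 1))"
    by (rule vertical_quads[of label2 label4 "solution a b" "solution a (b + 1)" "label3 b",
        OF solution_quads_24 solution_quads_24 solution_nondeg(2) nondeg(5,6)]) (simp_all add: U)
qed

lemma solution_quads_mixed:
  "quad (label1 a) (label2 c) (solution a b c d) (solution (a + 1) b c d) (solution a b (c + 1) d) (solution (a + 1) b (c + 1) d)"
  "quad (label1 a) (label4 d) (solution a b c d) (solution (a + 1) b c d) (solution a b c (d + 1)) (solution (a + 1) b c (d + 1))"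
  "quad (label3 b) (label2 c) (solution a b c d) (solution a (b + 1) c d) (solution a b (c + 1) d) (solution a (b + 1) (c + 1) d)"
  "quad (label3 b) (label4 d) (solution a b c d) (solution a (b + 1) c d) (solution a b c (d + 1)) (solution a (b + 1) c (d + 1))"
  using solution_vertical quad_swap by blast+

text \<open>For \<open>d = c\<close> this is the construction of \<open>level0\<close>; the mixed
  quads carry it along direction 4 both ways.\<close>

lemma solution_quads_13: "quad (label1 a) (label3 b) (solution a b c d) (solution (a + 1) b c d) (solution a (b + 1) c d) (solution (a + 1) (b + 1) c d)"
proof (induction d rule: int_induct[where k = c])
  case base
  show ?case using level_quads(1) by (simp add: solution_def)
next
  case (step1 d)
  show ?case
    by (rule quad_transport[OF solution_quads_mixed(2,4,2) step1(2) solution_nondeg(1,4,6)])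
next
  case (step2 d)
  \<comment> \<open>For a step down, the cube is read with direction 4 reversed, which negates its
    label.\<close>
  have flipped: "quad (label1 a) (- label4 (d - 1)) (solution a b c d) (solution (a + 1) b c d) (solution a b c (d - 1)) (solution (a + 1) b c (d - 1))"
    "quad (label3 b) (- label4 (d - 1)) (solution a b c d) (solution a (b + 1) c d) (solution a b c (d - 1)) (solution a (b + 1) c (d - 1))"
    "nondeg (label1 a) (- label4 (d - 1)) (solution a b c d) (solution (a + 1) b c d) (solution a b c (d - 1)) (solution (a + 1) b c (d - 1))"
    "nondeg (label3 b) (- label4 (d - 1)) (solution a b c d) (solution a (b + 1) c d) (solution a b c (d - 1)) (solution a (b + 1) c (d - 1))"
    for a b
    using solution_quads_mixed(2,4)[of _ "d - 1"] solution_nondeg(4)[of a "d - 1" b c] solution_nondeg(6)[of b "d - 1" a c]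
    by (simp_all add: quad_flip' nondeg_flip')
  show ?case
    by (rule quad_transport[OF flipped(1,2,1) step2(2) solution_nondeg(1) flipped(3,4)])
qed

lemma induced_label_shift:
  assumes "i \<noteq> j"
  shows "induced_label t i (x + edir j) = induced_label t i x"
proof (cases x rule: pt_cases)
  case (1 a b c d)
  show ?thesis
    using assms exhaust_4[of i] exhaust_4[of j] by (auto simp: 1)
qed

lemma C_minus_lattice_exists:
  obtains f s where "cross_ratio_system f (induced_label t)"
    "\<And>i x. edge_diff f i x = induced_label t i x * s (x + edir i) * s x"
    "\<And>x. s (diagonal x) = alternate x (r x)" "\<And>x. s (diagonal x + edir 1) = alternate x (1 / l x)"
    "\<And>x. s (diagonal x + edir 2) = alternate x (1 / m x)"
proof -
  define s where "s x = solution (x $ 1) (x $ 3) (x $ 2) (x $ 4)" for x :: "int ^ 4"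
  have s_pt [simp]: "s (pt a b c d) = solution a b c d" for a b c d
    by (simp add: s_def)
  have quads: "quad (induced_label t i x) (induced_label t j x) (s x) (s (x + edir i)) (s (x + edir j)) (s (x + edir i + edir j))"
    and nondegs: "nondeg (induced_label t i x) (induced_label t j x) (s x) (s (x + edir i)) (s (x + edir j)) (s (x + edir i + edir j))"
    if "i \<noteq> j" for i j x
  proof -
    obtain a b c d where x: "x = pt a b c d"
      by (rule pt_cases)
    show "quad (induced_label t i x) (induced_label t j x) (s x) (s (x + edir i)) (s (x + edir j)) (s (x + edir i + edir j))"
      unfolding x
      using \<open>i \<noteq> j\<close> exhaust_4[of i] exhaust_4[of j]
        solution_quads_13 solution_quads_24 solution_quads_mixed solution_quads_13[THEN quad_swap[THEN iffD1]]
        solution_quads_24[THEN quad_swap[THEN iffD1]] solution_quads_mixed[THEN quad_swap[THEN iffD1]]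
      by auto
    have reached: "reached y (s y)" for y
      by (cases y rule: pt_cases) (simp add: reached_solution)
    show "nondeg (induced_label t i x) (induced_label t j x) (s x) (s (x + edir i)) (s (x + edir j)) (s (x + edir i + edir j))"
      by (rule reached_nondeg[OF that reached reached reached reached])
  qed
  have "induced_label t i x \<noteq> 0" for i x
    by (simp add: induced_label_def nonzero)
  then obtain f where "cross_ratio_system f (induced_label t)"
    "\<And>i x. edge_diff f i x = induced_label t i x * s (x + edir i) * s x"
    using cross_ratio_system_of_quads[OF induced_label_shift _ quads nondegs] by metis
  then show ?thesis
    by (rule that) (simp_all add: diagonal_pt init00_def init10_def init01_def vector_2_eta)
qed

end

section \<open>Duality and normalization of the constructed lattice\<close>

lemma even_shift_4:
  "even ((x + edir i) $ 1 + (x + edir i) $ 2 + (x + edir i) $ 3 + (x + edir i) $ 4) \<longleftrightarrow>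
   odd (x $ 1 + (x :: int ^ 4) $ 2 + x $ 3 + x $ 4)"
  using exhaust_4[of i] by (auto simp: axis_def)

lemma K_net_gauge_to_C_minus:
  assumes "Q \<in> K_net_representation"
  shows "\<exists>P\<in>C_minus_representation. gauge_transformable Q P"
proof -
  obtain r t l m where Q: "Q = (K_net_matrix r t l 1, K_net_matrix r t m 2)"
    and r: "\<And>x. norm (r x) = 1" and t: "\<And>i x. norm (t i x) = 1" and label: "labelling t"
    and lm: "\<And>x. l x \<noteq> 0" "\<And>x. m x \<noteq> 0"
    and quat: "\<And>x z. z > 0 \<Longrightarrow>
         quaternionic (K_net_matrix r t l 1 x z) \<and> quaternionic (K_net_matrix r t m 2 x z)"
    and nd: "nondegenerate r t l m"
    and comp: "compatible (K_net_matrix r t l 1) (K_net_matrix r t m 2)"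
    using assms unfolding K_net_representation_def by blast
  have nz: "r x \<noteq> 0" "t i x \<noteq> 0" for i x
    using r[of x] t[of i x] by auto
  let ?\<alpha> = "induced_label t"
  obtain f s where cr: "cross_ratio_system f ?\<alpha>"
    and edge: "\<And>i x. edge_diff f i x = ?\<alpha> i x * s (x + edir i) * s x"
    and s: "\<And>x. s (diagonal x) = alternate x (r x)" "\<And>x. s (diagonal x + edir 1) = alternate x (1 / l x)"
    "\<And>x. s (diagonal x + edir 2) = alternate x (1 / m x)"
    by (rule C_minus_lattice_exists[OF nd label nz lm comp]) blast
  have \<alpha>: "?\<alpha> 1 (diagonal x) = 1 / t 1 x" "?\<alpha> 3 (diagonal x) = t 1 x"
    "?\<alpha> 2 (diagonal x) = 1 / t 2 x" "?\<alpha> 4 (diagonal x) = t 2 x" for x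
    by (simp_all add: induced_label_def diagonal_def vector_2_eta)
  have shift: "?\<alpha> i (x + edir j) = ?\<alpha> i x" if "i \<noteq> j" for i j x
    using cr that unfolding cross_ratio_system_def by blast
  have gauge: "gauge_transformable (C_minus_L f ?\<alpha>, C_minus_M f ?\<alpha>) Q"
    unfolding Q by (rule gauge_transformable_C_minus_K_net[OF edge shift \<alpha> s nz lm])
  then have gauge': "gauge_transformable Q (C_minus_L f ?\<alpha>, C_minus_M f ?\<alpha>)"
    by (rule gauge_transformable_sym)
  then have comp': "compatible (C_minus_L f ?\<alpha>) (C_minus_M f ?\<alpha>)"
    using gauge_transformable_compatible comp unfolding Q by blast
  have unit: "norm (?\<alpha> i x) = 1" for i x
    by (simp add: induced_label_def t norm_divide)
  note quad = cross_ratio_system_quad[OF cr edge]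

  \<comment> \<open>Quad equation and quaternion condition share the factor
    \<open>X = s / a + a * w\<close>, which is nonzero by nondegeneracy and can be
    cancelled.\<close>
  have *: "u * cnj v = 1"
    if "quad (1 / a) a s u v w" "nondeg (1 / a) a s u v w" "a * s + w / a = u * cnj u * (s / a + a * w)"
    for a s u v w
  proof -
    have "u * (a * w + s * (1 / a)) = v * (w * (1 / a) + a * s)"
      using that(1) unfolding quad_def by algebra
    then have "u * (s / a + a * w) = v * (a * s + w / a)"
      by (simp add: algebra_simps)
    moreover define X where "X = s / a + a * w"
    ultimately have "u * X = v * (u * cnj u * X)"
      unfolding that(3) by simp
    then have "u * X * (cnj u * v - 1) = 0"
      by algebra
    moreover have "u * X \<noteq> 0"
      using that(2) by (simp add: nondeg_def X_def)
    ultimately have "cnj u * v = 1"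
      by simp
    then have "cnj (cnj u * v) = 1"
      by simp
    then show ?thesis by simp
  qed
  have dual: "s (diagonal x + edir 1) * cnj (s (diagonal x + edir 3)) = 1"
    "s (diagonal x + edir 2) * cnj (s (diagonal x + edir 4)) = 1" for x
  proof -
    \<comment> \<open>The condition is the same for every positive parameter; it is read off at
      \<open>z = 1\<close>.\<close>
    have "t 1 x * s (diagonal x) + s (diagonal (x + edir 1)) / t 1 x =
        s (diagonal x + edir 1) * cnj (s (diagonal x + edir 1)) * (s (diagonal x) / t 1 x + t 1 x * s (diagonal (x + edir 1)))"
      using quat[of 1 x] quaternionic_K_net_iff[where r = r and t = t and l = l and k = 1 and x = x and z = 1, OF r r t lm(1) _ refl refl refl]
      by (simp add: s)
    then show "s (diagonal x + edir 1) * cnj (s (diagonal x + edir 3)) = 1"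
      using quad[of 1 3 "diagonal x"] *[of "t 1 x"] by (simp add: \<alpha> diagonal_shift)
    have "t 2 x * s (diagonal x) + s (diagonal (x + edir 2)) / t 2 x =
        s (diagonal x + edir 2) * cnj (s (diagonal x + edir 2)) * (s (diagonal x) / t 2 x + t 2 x * s (diagonal (x + edir 2)))"
      using quat[of 1 x] quaternionic_K_net_iff[where r = r and t = t and l = m and k = 2 and x = x and z = 1, OF r r t lm(2) _ refl refl refl]
      by (simp add: s)
    then show "s (diagonal x + edir 2) * cnj (s (diagonal x + edir 4)) = 1"
      using quad[of 2 4 "diagonal x"] *[of "t 2 x"] by (simp add: \<alpha> diagonal_shift)
  qed

  define ev where "ev x \<longleftrightarrow> even (x $ 1 + x $ 2 + x $ 3 + x $ 4)" for x :: "int ^ 4"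
  have ev_shift: "ev (x + edir i) \<longleftrightarrow> \<not> ev x" for x i
    unfolding ev_def even_shift_4 by simp
  have ev_diagonal: "ev (diagonal x)" for x
    by (simp add: ev_def diagonal_def)
  \<comment> \<open>Dividing \<open>s\<close> by \<kappa> at even vertices and multiplying by it at
    odd ones leaves the products over edges unchanged and makes the value at 0 equal to 1. The
    duality relates two odd vertices and picks up the factor \<open>\<kappa> * cnj \<kappa>\<close>,
    which is 1 because \<open>r 0\<close> is unitary.\<close>
  define \<kappa> where "\<kappa> = s 0"
  have "diagonal 0 = 0"
    by (simp add: diagonal_def vec_eq_iff forall_4)
  then have "\<kappa> = r 0"
    using s(1)[of 0] by (simp add: \<kappa>_def alternate_def)
  then have \<kappa>: "\<kappa> * cnj \<kappa> = 1" "\<kappa> \<noteq> 0"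
    using r[of 0] complex_norm_square[of \<kappa>] by auto
  define s' where "s' x = (if ev x then s x / \<kappa> else s x * \<kappa>)" for x
  have "s_map_of f ?\<alpha> s'"
    unfolding s_map_of_def
  proof (intro conjI allI)
    show "s' 0 = 1"
      using \<kappa> by (simp add: s'_def ev_def \<kappa>_def)
    show "edge_diff f i x = ?\<alpha> i x * s' (x + edir i) * s' x" for i x
      using \<kappa> by (simp add: s'_def ev_shift edge)
  qed
  moreover have "s' (diagonal x + edir i) * cnj (s' (diagonal x + edir j)) =
      s (diagonal x + edir i) * cnj (s (diagonal x + edir j)) * (\<kappa> * cnj \<kappa>)" for x i j
    by (simp add: s'_def ev_shift ev_diagonal)
  moreover have "1 / t k x = cnj (t k x)" for k x
    using t[of k x] by (metis complex_div_cnj complex_norm_square div_by_1 mult_1 of_real_1 power_one)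
  ultimately have "C_minus_lattice f ?\<alpha>"
    unfolding C_minus_lattice_def using cr by (intro conjI exI[of _ s']) (auto simp: dual \<kappa> \<alpha>)
  then have "(C_minus_L f ?\<alpha>, C_minus_M f ?\<alpha>) \<in> C_minus_representation"
    unfolding C_minus_representation_def using unit comp' by blast
  then show ?thesis
    using gauge' by blast
qed

theorem theorem4p10: "gauge_equivalent K_net_representation C_minus_representation"
  unfolding gauge_equivalent_def using K_net_gauge_to_C_minus C_minus_gauge_to_K_net by blast

end
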